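(* Let $n\ge1$, let $\psi:[0,\infty)\to[0,\infty)$ be an increasing (not necessarily continuous) function such that $$\int_0^\infty\frac{\psi(x)}{1+x^2}\,dx=\infty,$$ and let $\mu$ be a complex (finite) Borel measure on $\mathbb{R}^n$ satisfying $$\int_{\mathbb{R}^n}e^{\psi(|x|)}\,d|\mu|(x)<\infty.$$ If $1<p\le\infty$ and $f\in L^p(\mathbb{R}^n,|\mu|)$ is such that $\widehat{f\,d\mu}$ vanishes on a set $\Lambda=\Lambda_1\times\cdots\times\Lambda_n\subset\mathbb{R}^n$, where each $\Lambda_j\subset\mathbb{R}$ is a closed set of positive Lebesgue measure, then $f=0$ $\mu$-almost everywhere.
   Context: $|x|$ is the Euclidean norm and $x\cdot y$ the Euclidean inner product on $\mathbb{R}^n$. "Increasing" means $x\le y\Rightarrow\psi(x)\le\psi(y)$. $|\mu|$ is the total variation measure of $\mu$; "$\mu$-almost everywhere" means $|\mu|$-almost everywhere. $f\,d\mu$ is the complex measure with density $f$ with respect to $\mu$, and $\widehat{f\,d\mu}(\lambda)=\int_{\mathbb{R}^n}e^{-i\lambda\cdot x}f(x)\,d\mu(x)$ for $\lambda\in\mathbb{R}^n$. *)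

theory Defs
  imports "HOL-Probability.Essential_Supremum"
begin

definition complex_measure :: "'a measure \<Rightarrow> ('a set \<Rightarrow> complex) \<Rightarrow> bool" where
  "complex_measure M \<mu> \<longleftrightarrow>
     (\<forall>A :: nat \<Rightarrow> 'a set. range A \<subseteq> sets M \<longrightarrow> disjoint_family A \<longrightarrow>
        (\<lambda>i. \<mu> (A i)) sums \<mu> (\<Union>i. A i))"

text \<open>
  For a complex measure the set functions handed to \<^const>\<open>measure_of\<close> in the next two
  definitions are countably additive on the sets of \<open>M\<close>, so they are the actual values of the
  resulting measures. (For a set function that is not countably additive,
  \<^const>\<open>measure_of\<close> would return the null measure.)
\<close>

definition total_variation :: "'a measure \<Rightarrow> ('a set \<Rightarrow> complex) \<Rightarrow> 'a measure" where
  "total_variation M \<mu> = measure_of (space M) (sets M)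
     (\<lambda>E. SUP A \<in> {A :: nat \<Rightarrow> 'a set. range A \<subseteq> sets M \<and> disjoint_family A \<and> (\<Union>i. A i) = E}.
            (\<Sum>i. ennreal (norm (\<mu> (A i)))))"

text \<open>
  The positive part of the Jordan decomposition of a finite signed measure \<open>\<nu>\<close>; the negative part
  is the positive part of \<open>- \<nu>\<close>. Negative values of \<open>\<nu>\<close> are truncated to \<open>0\<close> by \<^const>\<open>ennreal\<close>,
  which does not affect the supremum because the empty set contributes \<open>0\<close>.
\<close>

definition positive_variation :: "'a measure \<Rightarrow> ('a set \<Rightarrow> real) \<Rightarrow> 'a measure" where
  "positive_variation M \<nu> = measure_of (space M) (sets M)
     (\<lambda>E. SUP A \<in> {A \<in> sets M. A \<subseteq> E}. ennreal (\<nu> A))"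

definition complex_measure_integral ::
    "'a measure \<Rightarrow> ('a set \<Rightarrow> complex) \<Rightarrow> ('a \<Rightarrow> complex) \<Rightarrow> complex" where
  "complex_measure_integral M \<mu> f =
     ((\<integral>x. f x \<partial>positive_variation M (\<lambda>E. Re (\<mu> E)))
       - (\<integral>x. f x \<partial>positive_variation M (\<lambda>E. - Re (\<mu> E))))
     + \<i> * ((\<integral>x. f x \<partial>positive_variation M (\<lambda>E. Im (\<mu> E)))
       - (\<integral>x. f x \<partial>positive_variation M (\<lambda>E. - Im (\<mu> E))))"

definition in_Lp :: "ennreal \<Rightarrow> 'a measure \<Rightarrow> ('a \<Rightarrow> complex) \<Rightarrow> bool" where
  "in_Lp p M f \<longleftrightarrow> f \<in> borel_measurable M \<and>
     (if p = \<infinity> then esssup M (\<lambda>x. ennreal (norm (f x))) < \<infinity>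
      else (\<integral>\<^sup>+x. ennreal (norm (f x) powr enn2real p) \<partial>M) < \<infinity>)"

text \<open>The Fourier transform of the complex measure \<open>f d\<mu>\<close>.\<close>

definition fourier_density ::
    "((real ^ 'n) set \<Rightarrow> complex) \<Rightarrow> (real ^ 'n \<Rightarrow> complex) \<Rightarrow> real ^ 'n \<Rightarrow> complex" where
  "fourier_density \<mu> f l =
     complex_measure_integral borel \<mu> (\<lambda>x. exp (- (\<i> * complex_of_real (l \<bullet> x))) * f x)"

end

(*
  By Hoelder's (here Young's) inequality f dmu integrates exp (phi |x|), where phi = psi / q for the
  conjugate exponent q of p, and the logarithmic integral of phi still diverges. Freezing all
  frequencies but one, and replacing exponentials by indicator functions coordinate by coordinate,
  reduces the claim to one dimension: if F is the Fourier transform of a measure on the line with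
  tails at most exp (- phi a) and F = 0 on a set E of positive measure, then F = 0.

  The one-dimensional statement is proved in the spirit of Bang's proof of the Denjoy-Carleman
  theorem. If |F| <= exp (- s) on half of an interval of length d <= c s / a, where phi a >= s, then
  |F| <= exp (- s / 16) on the whole interval: cut the measure off at a, compare with a Taylor
  polynomial and apply a Remez inequality. Now let B k be the part of a bounded interval J on which
  |F| > exp (- 16 ^ k), and let d k = min w (c 16 ^ k / a k), where a k is almost the first point with
  phi (a k) >= 16 ^ k. As long as B (k - 1) is nonempty it is smaller than B k by at least d k / 2.
  Divergence of the logarithmic integral means that the sum of the d k diverges, so all B k are empty.
*)
theory Submission
  imports Defs "HOL-Probability.Probability"
begin

subsection \<open>A Remez inequality\<close>

text \<open>The transform need not be analytic, so vanishing cannot be continued from a point. What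
  travels is a bound that holds on a fixed proportion of a window, which is the kind of input that
  the Remez inequality accepts. Each passage from half a window to the whole window divides the
  exponent by 16. The levels have exactly this ratio, so a bound at level \<open>k + 1\<close> on
  half of a window becomes the bound at level \<open>k\<close> on all of it. This loss is affordable
  because the logarithmic integral need only be probed at geometric levels: the part where
  \<open>\<phi>\<close> lies between \<open>16 ^ k\<close> and \<open>16 ^ (k + 1)\<close>
  contributes at most a constant times \<open>16 ^ k / a k\<close>. The same ratio is, up to a
  constant, the length of a window on which a Taylor polynomial of degree about
  \<open>16 ^ k / 8\<close> is accurate after the measure is cut off at \<open>a k\<close>. This is
  why divergence of the integral becomes divergence of the sum of the window lengths.\<close>

lemma poly_lagrange_interpolation:
  fixes P :: "'a::field poly" and x :: "nat \<Rightarrow> 'a"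
  assumes inj: "inj_on x {..<n}" and deg: "degree P < n"
  shows "poly P z = (\<Sum>i<n. poly P (x i) * (\<Prod>j\<in>{..<n} - {i}. (z - x j) / (x i - x j)))"
proof -
  define Q where "Q = (\<Sum>i<n. smult (poly P (x i)) (\<Prod>j\<in>{..<n} - {i}. smult (1 / (x i - x j)) [:- x j, 1:]))"
  have Q: "poly Q y = (\<Sum>i<n. poly P (x i) * (\<Prod>j\<in>{..<n} - {i}. (y - x j) / (x i - x j)))" for y
    unfolding Q_def by (simp add: poly_sum poly_prod diff_divide_distrib)
  have "degree Q \<le> n - 1"
    unfolding Q_def
  proof (rule degree_sum_le)
    fix i assume "i \<in> {..<n}"
    then have "sum (degree \<circ> (\<lambda>j. smult (1 / (x i - x j)) [:- x j, 1:])) ({..<n} - {i}) \<le> (\<Sum>j\<in>{..<n} - {i}. 1)"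
      by (intro sum_mono) (auto intro: order.trans[OF degree_smult_le])
    also have "\<dots> = n - 1" using \<open>i \<in> {..<n}\<close> by simp
    finally have "degree (\<Prod>j\<in>{..<n} - {i}. smult (1 / (x i - x j)) [:- x j, 1:]) \<le> n - 1"
      using degree_prod_sum_le[of "{..<n} - {i}"] by (meson finite_Diff finite_lessThan le_trans)
    then show "degree (smult (poly P (x i)) (\<Prod>j\<in>{..<n} - {i}. smult (1 / (x i - x j)) [:- x j, 1:])) \<le> n - 1"
      using degree_smult_le le_trans by blast
  qed simp
  moreover have "card (x ` {..<n}) = n" using inj by (simp add: card_image)
  moreover have "poly P y = poly Q y" if "y \<in> x ` {..<n}" for y
  proof -
    from that obtain k where k: "k < n" "y = x k" by auto
    have "(\<Prod>j\<in>{..<n} - {i}. (x k - x j) / (x i - x j)) = (if i = k then 1 else 0)" if "i < n" for i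
    proof (cases "i = k")
      case True
      have "(\<Prod>j\<in>{..<n} - {i}. (x k - x j) / (x i - x j)) = (\<Prod>j\<in>{..<n} - {i}. 1)"
        using True inj k by (intro prod.cong) (auto simp: inj_on_def)
      then show ?thesis using True by simp
    next
      case False
      then show ?thesis using k by (auto intro!: prod_zero)
    qed
    then have "poly Q y = (\<Sum>i<n. poly P (x i) * (if i = k then 1 else 0))"
      unfolding Q k by (intro sum.cong) auto
    then show ?thesis using k by (simp add: sum.delta if_distrib cong: if_cong)
  qed
  ultimately have "P = Q" using deg
    by (intro poly_eqI_degree[where A = "x ` {..<n}"]) auto
  then have "poly P z = poly Q z" by (rule arg_cong)
  also note Q
  finally show ?thesis .
qed

lemma fmeasurable_lborel_Icc:
  fixes S :: "real set"
  assumes "S \<in> sets borel" "S \<subseteq> {a..b}"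
  shows "S \<in> fmeasurable lborel"
  by (rule fmeasurableI2[OF fmeasurable_compact[OF compact_Icc[of a b]]]) (use assms in auto)

text \<open>Greedy choice from the left: take a point within \<open>e\<close> of the infimum and
  discard everything below \<open>x0 + h\<close>, which costs less than \<open>h + e\<close> of
  measure. The slack \<open>e\<close> comes from the strict inequality in the hypothesis and pays
  for an infimum that \<open>G\<close> may not attain.\<close>

lemma exists_separated_points:
  fixes G :: "real set" and h :: real
  assumes "G \<in> sets borel" "G \<subseteq> {a..b}" "0 < h" "real n * h < measure lborel G"
  shows "\<exists>x. (\<forall>i<n. x i \<in> G) \<and> (\<forall>i j. i \<le> j \<longrightarrow> j < n \<longrightarrow> real (j - i) * h \<le> x j - x i)"
  using assms
proof (induction n arbitrary: G)
  case 0
  then show ?case by auto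
next
  case (Suc n)
  have "G \<noteq> {}" using Suc.prems by (auto simp: mult_less_0_iff)
  have bdd: "bdd_below G" using Suc.prems(2) by (meson bdd_below_Icc bdd_below_mono)
  define e where "e = measure lborel G - real (Suc n) * h"
  have "e > 0" using Suc.prems(4) by (simp add: e_def)
  then obtain x0 where x0: "x0 \<in> G" "x0 < Inf G + e"
    using cInf_lessD[of G "Inf G + e"] \<open>G \<noteq> {}\<close> by auto
  define G' where "G' = G \<inter> {x0 + h..}"
  have G'b: "G' \<in> sets borel" "G' \<subseteq> {a..b}" using Suc.prems by (auto simp: G'_def)
  have G'f: "G' \<in> fmeasurable lborel"
    using G'b by (rule fmeasurable_lborel_Icc)
  have "G \<subseteq> G' \<union> {Inf G..x0 + h}"
    using bdd by (auto simp: G'_def cInf_lower)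
  then have "measure lborel G \<le> measure lborel (G' \<union> {Inf G..x0 + h})"
    using Suc.prems(1) G'f fmeasurable_lborel_Icc[of "{Inf G..x0 + h}"]
    by (intro measure_mono_fmeasurable fmeasurable.Un) auto
  also have "\<dots> \<le> measure lborel G' + measure lborel {Inf G..x0 + h}"
    using G'b by (intro measure_Un_le) auto
  also have "measure lborel {Inf G..x0 + h} = x0 + h - Inf G"
    using cInf_lower[OF x0(1) bdd] Suc.prems(3) by simp
  finally have "real n * h < measure lborel G'"
    using x0 by (simp add: e_def algebra_simps)
  from Suc.IH[OF G'b Suc.prems(3) this] obtain x where
    x: "\<And>i. i < n \<Longrightarrow> x i \<in> G'" "\<And>i j. i \<le> j \<Longrightarrow> j < n \<Longrightarrow> real (j - i) * h \<le> x j - x i" by blast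
  define y where "y i = (case i of 0 \<Rightarrow> x0 | Suc k \<Rightarrow> x k)" for i
  have "y i \<in> G" if "i < Suc n" for i
    using that x(1) x0 by (cases i) (auto simp: y_def G'_def)
  moreover have "real (j - i) * h \<le> y j - y i" if "i \<le> j" "j < Suc n" for i j
  proof (cases j)
    case 0 then show ?thesis using that by simp
  next
    case (Suc k)
    show ?thesis
    proof (cases i)
      case 0
      have "real k * h \<le> x k - x 0" using x(2)[of 0 k] Suc that by simp
      moreover have "x0 + h \<le> x 0" using x(1)[of 0] Suc that by (auto simp: G'_def)
      ultimately show ?thesis using Suc 0 by (simp add: y_def algebra_simps)
    next
      case (Suc l)
      then show ?thesis using \<open>j = Suc k\<close> that x(2)[of l k] by (simp add: y_def)
    qed
  qed
  ultimately show ?case by blast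
qed

lemma prod_dist_index:
  "i < n \<Longrightarrow> (\<Prod>j\<in>{..<n} - {i}. \<bar>real i - real j\<bar>) = fact i * fact (n - Suc i)"
proof -
  assume i: "i < n"
  have split: "{..<n} - {i} = {..<i} \<union> {Suc i..<n}" using i by auto
  have "(\<Prod>j\<in>{..<n} - {i}. \<bar>real i - real j\<bar>) =
      (\<Prod>j\<in>{..<i}. \<bar>real i - real j\<bar>) * (\<Prod>j\<in>{Suc i..<n}. \<bar>real i - real j\<bar>)"
    unfolding split by (rule prod.union_disjoint) auto
  also have "(\<Prod>j\<in>{..<i}. \<bar>real i - real j\<bar>) = (\<Prod>j\<in>{1..i}. real j)"
    by (rule prod.reindex_bij_witness[of _ "\<lambda>j. i - j" "\<lambda>j. i - j"]) (auto simp: of_nat_diff)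
  also have "\<dots> = fact i" by (simp add: fact_prod)
  also have "(\<Prod>j\<in>{Suc i..<n}. \<bar>real i - real j\<bar>) = (\<Prod>j\<in>{1..n - Suc i}. real j)"
    by (rule prod.reindex_bij_witness[of _ "\<lambda>j. j + i" "\<lambda>j. j - i"]) (auto simp: of_nat_diff)
  also have "\<dots> = fact (n - Suc i)" by (simp add: fact_prod)
  finally show ?thesis .
qed

text \<open>A single term of the exponential series; it stands in for Stirling's formula
  below.\<close>

lemma power_self_le_exp_fact: "real n ^ n \<le> exp (real n) * fact n"
proof -
  have "real n ^ n / fact n = (\<Sum>k\<in>{n}. real n ^ k /\<^sub>R fact k)"
    by (simp add: divide_inverse mult.commute)
  also have "\<dots> \<le> (\<Sum>k. real n ^ k /\<^sub>R fact k)"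
    by (intro sum_le_suminf summable_exp_generic) auto
  finally have "real n ^ n / fact n \<le> exp (real n)" by (simp add: exp_def)
  then show ?thesis by (simp add: divide_simps)
qed

text \<open>Lagrange interpolation at \<open>n\<close> points of \<open>G\<close> with gaps of at
  least \<open>h\<close>. The basis polynomials are then bounded as for equally spaced nodes, and
  these bounds sum up to a row of binomial coefficients. The constant is cruder than the one from
  Chebyshev polynomials, but also exponential in \<open>n\<close>.\<close>

lemma remez_inequality:
  fixes P :: "complex poly" and G :: "real set"
  assumes deg: "degree P < n"
    and G: "G \<in> sets borel" "G \<subseteq> {t..t + d}" "d / 2 \<le> measure lborel G"
    and d: "0 < d" and small: "\<And>y. y \<in> G \<Longrightarrow> norm (poly P (of_real y)) \<le> e"
    and z: "z \<in> {t..t + d}"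
  shows "norm (poly P (of_real z)) \<le> exp (4 * real n) * e"
proof -
  have n: "n > 0" using deg by simp
  \<comment> \<open>\<open>n * h = d / 4\<close> stays strictly below the measure of
    \<open>G\<close>, which is at least \<open>d / 2\<close>.\<close>
  define h where "h = d / (4 * real n)"
  have h: "h > 0" using n d by (simp add: h_def)
  have "real n * h < measure lborel G" using n d G(3) by (simp add: h_def)
  from exists_separated_points[OF G(1,2) h this] obtain x where
    x: "\<And>i. i < n \<Longrightarrow> x i \<in> G" "\<And>i j. i \<le> j \<Longrightarrow> j < n \<Longrightarrow> real (j - i) * h \<le> x j - x i" by blast
  have sep: "\<bar>real i - real j\<bar> * h \<le> \<bar>x i - x j\<bar>" if "i < n" "j < n" for i j
  proof (cases "i \<le> j")
    case True then show ?thesis using x(2)[of i j] that h by (simp add: of_nat_diff)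
  next
    case False then show ?thesis using x(2)[of j i] that h by (simp add: of_nat_diff)
  qed
  have e: "e \<ge> 0" using small[OF x(1)[OF n]] norm_ge_zero order_trans by blast
  have inj: "inj_on (\<lambda>i. complex_of_real (x i)) {..<n}"
  proof (rule inj_onI)
    fix i j assume "i \<in> {..<n}" "j \<in> {..<n}" "complex_of_real (x i) = of_real (x j)"
    then have "\<bar>real i - real j\<bar> * h \<le> 0" using sep[of i j] by simp
    then show "i = j" using h by (simp add: mult_le_0_iff)
  qed
  have summand: "norm (poly P (of_real (x i)) * (\<Prod>j\<in>{..<n} - {i}. (of_real z - of_real (x j)) / (of_real (x i) - of_real (x j))))
      \<le> e * ((4 * real n) ^ (n - 1) / (fact i * fact (n - Suc i)))" if i: "i < n" for i
  proof -
    have "norm (\<Prod>j\<in>{..<n} - {i}. (of_real z - of_real (x j)) / (complex_of_real (x i) - of_real (x j)))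
      = (\<Prod>j\<in>{..<n} - {i}. \<bar>z - x j\<bar> / \<bar>x i - x j\<bar>)"
      by (simp add: prod_norm[symmetric] norm_divide flip: of_real_diff)
    also have "\<dots> \<le> (\<Prod>j\<in>{..<n} - {i}. (4 * real n) / \<bar>real i - real j\<bar>)"
    proof (rule prod_mono, rule conjI)
      fix j assume j: "j \<in> {..<n} - {i}"
      then have pos: "\<bar>real i - real j\<bar> * h > 0" using h by auto
      have "x j \<in> {t..t + d}" using x(1)[of j] j G(2) by auto
      then have "\<bar>z - x j\<bar> \<le> d" using z by auto
      then have "\<bar>z - x j\<bar> / \<bar>x i - x j\<bar> \<le> d / (\<bar>real i - real j\<bar> * h)"
        using sep[of i j] i j pos d by (intro frac_le) auto
      also have "\<dots> = (4 * real n) / \<bar>real i - real j\<bar>" using d n by (simp add: h_def)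
      finally show "\<bar>z - x j\<bar> / \<bar>x i - x j\<bar> \<le> (4 * real n) / \<bar>real i - real j\<bar>" .
    qed simp
    also have "\<dots> = (4 * real n) ^ (n - 1) / (fact i * fact (n - Suc i))"
      using i by (simp add: prod_dividef prod_dist_index)
    finally show ?thesis
      using small[OF x(1)[OF i]] e unfolding norm_mult by (intro mult_mono) auto
  qed
  obtain m where m: "n = Suc m" using n gr0_implies_Suc by blast
  have "norm (poly P (of_real z)) \<le> (\<Sum>i<n. e * ((4 * real n) ^ (n - 1) / (fact i * fact (n - Suc i))))"
    using poly_lagrange_interpolation[OF inj deg, of "of_real z"] summand
    by (auto intro!: order.trans[OF norm_sum] sum_mono)
  also have "\<dots> = e * (4 * real n) ^ m * (\<Sum>i\<le>m. 1 / (fact i * fact (m - i)))"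
    by (simp add: m sum_distrib_left lessThan_Suc_atMost)
  also have "(\<Sum>i\<le>m. 1 / (fact i * fact (m - i))) = (\<Sum>i\<le>m. real (m choose i) / fact m)"
    by (intro sum.cong) (auto simp: binomial_fact)
  also have "\<dots> = 2 ^ m / fact m"
    using choose_row_sum[of m, THEN arg_cong[where f = real]] by (simp flip: sum_divide_distrib)
  also have "e * (4 * real n) ^ m * (2 ^ m / fact m) = e * 8 ^ m * (real n ^ n / fact n)"
  proof -
    have "(8::real) ^ m = 4 ^ m * 2 ^ m" by (simp flip: power_mult_distrib)
    moreover have "real n ^ n / fact n = real n ^ m / fact m"
      using n by (simp add: m del: of_nat_Suc)
    ultimately show ?thesis by (simp add: power_mult_distrib)
  qed
  \<comment> \<open>\<open>8 ^ m\<close> costs \<open>exp (3 n)\<close> and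
    \<open>n ^ n / n!\<close> costs \<open>exp n\<close>; together they make up the factor
    \<open>exp (4 n)\<close>.\<close>
  also have "\<dots> \<le> e * exp 3 ^ n * exp (real n)"
  proof (rule mult_mono)
    have "(8::real) \<le> exp 3" 
      using power_mono[OF exp_ge_add_one_self[of "1::real"], of 3]
      using exp_of_nat_mult[of 3 "1::real"] by simp
    then have "8 ^ m \<le> exp (3::real) ^ m" by (rule power_mono) simp
    also have "\<dots> \<le> exp (3::real) ^ n" unfolding m by (rule power_increasing) auto
    finally show "e * 8 ^ m \<le> e * exp 3 ^ n" using e by (rule mult_left_mono)
    show "real n ^ n / fact n \<le> exp (real n)"
      using power_self_le_exp_fact[of n] by (simp add: divide_simps)
  qed (use e in auto)
  also have "exp 3 ^ n = exp (real n * 3)" by (rule exp_of_nat_mult[symmetric])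
  also have "e * exp (real n * 3) * exp (real n) = exp (4 * real n) * e"
    using exp_add[of "real n * 3" "real n"] by (simp add: mult.commute)
  finally show ?thesis .
qed

subsection \<open>Fourier integrals along a real function\<close>

text \<open>The Fourier transform on the line of the image under \<open>r\<close> of the complex
  measure with density \<open>h\<close>. Written as an integral over \<open>M\<close>, it does not
  require forming the image of a complex measure. Later \<open>r\<close> is a coordinate and
  \<open>M\<close> the total variation.\<close>

definition fourier_along :: "'a measure \<Rightarrow> ('a \<Rightarrow> real) \<Rightarrow> ('a \<Rightarrow> complex) \<Rightarrow> real \<Rightarrow> complex" where
  "fourier_along M r h l = (\<integral>x. iexp (- (l * r x)) * h x \<partial>M)"

lemma integrable_iexp_mult:
  fixes r :: "'a \<Rightarrow> real"
  assumes [measurable]: "r \<in> borel_measurable M" and h: "integrable M h"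
  shows "integrable M (\<lambda>x. iexp (- (l * r x)) * h x)"
proof (rule Bochner_Integration.integrable_bound[OF h])
  have [measurable]: "h \<in> borel_measurable M" using h by simp
  show "(\<lambda>x. iexp (- (l * r x)) * h x) \<in> borel_measurable M" by measurable
qed (simp add: norm_mult)

lemma norm_fourier_along_le:
  "norm (fourier_along M r h l) \<le> (\<integral>x. norm (h x) \<partial>M)"
proof -
  have "norm (fourier_along M r h l) \<le> (\<integral>x. norm (iexp (- (l * r x)) * h x) \<partial>M)"
    unfolding fourier_along_def by (rule integral_norm_bound)
  then show ?thesis by (simp add: norm_mult)
qed

lemma continuous_fourier_along:
  fixes r :: "'a \<Rightarrow> real"
  assumes [measurable]: "r \<in> borel_measurable M" and h: "integrable M h"
  shows "continuous_on UNIV (fourier_along M r h)"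
  unfolding continuous_on_sequentially fourier_along_def comp_def
proof (intro ballI allI impI, elim conjE)
  fix u :: "nat \<Rightarrow> real" and l assume u: "u \<longlonglongrightarrow> l"
  have [measurable]: "h \<in> borel_measurable M" using h by simp
  show "(\<lambda>n. \<integral>x. iexp (- (u n * r x)) * h x \<partial>M) \<longlonglongrightarrow> (\<integral>x. iexp (- (l * r x)) * h x \<partial>M)"
  proof (rule integral_dominated_convergence[where w = "\<lambda>x. norm (h x)"])
    show "AE x in M. (\<lambda>n. iexp (- (u n * r x)) * h x) \<longlonglongrightarrow> iexp (- (l * r x)) * h x"
      by (intro AE_I2 tendsto_intros u)
  qed (use h in \<open>auto simp: norm_mult\<close>)
qed

text \<open>Taylor expansion in the frequency about \<open>c\<close>. The remainder is uniform
  because \<open>\<bar>r\<bar>\<close> is at most \<open>a\<close> wherever \<open>h\<close> is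
  nonzero.\<close>

lemma fourier_along_poly_approx:
  fixes r :: "'a \<Rightarrow> real"
  assumes [measurable]: "r \<in> borel_measurable M" and h: "integrable M h"
    and h1: "(\<integral>x. norm (h x) \<partial>M) \<le> 1"
    and supp: "\<And>x. h x \<noteq> 0 \<Longrightarrow> \<bar>r x\<bar> \<le> a" and a: "0 \<le> a"
  obtains P where "degree P < Suc n"
    "\<And>l. norm (fourier_along M r h l - poly P (of_real l)) \<le> (a * \<bar>l - c\<bar>) ^ Suc n / fact (Suc n)"
proof -
  have [measurable]: "h \<in> borel_measurable M" using h by simp
  \<comment> \<open>The oscillation at frequency \<open>c\<close> is absorbed into \<open>g\<close>,
    so that only powers of \<open>l - c\<close> remain to be expanded.\<close>
  define g where "g x = iexp (- (c * r x)) * h x" for x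
  have g: "integrable M g" unfolding g_def using integrable_iexp_mult[OF assms(1) h] .
  have ng: "norm (g x) = norm (h x)" for x by (simp add: g_def norm_mult)
  define q where "q k x = (- \<i> * of_real (r x)) ^ k / fact k * g x" for k x
  have q: "integrable M (q k)" for k
  proof (rule Bochner_Integration.integrable_bound[of _ "\<lambda>x. a ^ k / fact k * norm (h x)"])
    show "integrable M (\<lambda>x. a ^ k / fact k * norm (h x))" using h by simp
    show "q k \<in> borel_measurable M" unfolding q_def g_def by measurable
    have "norm (q k x) \<le> a ^ k / fact k * norm (h x)" for x
    proof (cases "h x = 0")
      case False
      then show ?thesis using supp[of x] power_mono[of "\<bar>r x\<bar>" a k]
        by (simp add: q_def norm_mult norm_divide norm_power ng mult_right_mono divide_right_mono)
    qed (simp add: q_def g_def)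
    then show "AE x in M. norm (q k x) \<le> norm (a ^ k / fact k * norm (h x))"
      using a by (intro AE_I2) simp
  qed
  define P where "P = (\<Sum>k\<le>n. smult (\<integral>x. q k x \<partial>M) ([:- of_real c, 1:] ^ k))"
  have "degree P \<le> n"
    unfolding P_def
  proof (rule degree_sum_le)
    fix k assume "k \<in> {..n}"
    have "degree (smult (\<integral>x. q k x \<partial>M) ([:- of_real c, 1:] ^ k)) \<le> degree ([:- complex_of_real c, 1:] ^ k)"
      by (rule degree_smult_le)
    also have "\<dots> \<le> k" using degree_power_le[of "[:- complex_of_real c, 1:]" k] by simp
    finally show "degree (smult (\<integral>x. q k x \<partial>M) ([:- of_real c, 1:] ^ k)) \<le> n"
      using \<open>k \<in> {..n}\<close> by simp
  qed simp
  moreover have "norm (fourier_along M r h l - poly P (of_real l)) \<le> (a * \<bar>l - c\<bar>) ^ Suc n / fact (Suc n)" for l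
  proof -
    define y where "y x = - ((l - c) * r x)" for x
    have "iexp (- (l * r x)) = iexp (y x) * iexp (- (c * r x))" for x
      unfolding exp_add[symmetric] by (simp add: y_def algebra_simps)
    then have F: "fourier_along M r h l = (\<integral>x. iexp (y x) * g x \<partial>M)"
      unfolding fourier_along_def g_def by (simp add: mult.assoc)
    have qy: "q k x * of_real (l - c) ^ k = (\<i> * y x) ^ k / fact k * g x" for k x
    proof -
      have "\<i> * y x = (- \<i> * of_real (r x)) * of_real (l - c)" by (simp add: y_def)
      then have "(\<i> * y x) ^ k = (- \<i> * of_real (r x)) ^ k * of_real (l - c) ^ k"
        by (simp only: power_mult_distrib)
      then show ?thesis by (simp add: q_def)
    qed
    have "poly P (of_real l) = (\<Sum>k\<le>n. \<integral>x. q k x * (of_real (l - c)) ^ k \<partial>M)"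
      by (simp add: P_def poly_sum poly_power)
    also have "\<dots> = (\<integral>x. (\<Sum>k\<le>n. q k x * (of_real (l - c)) ^ k) \<partial>M)"
      using q by (intro Bochner_Integration.integral_sum[symmetric] integrable_mult_left) auto
    also have "\<dots> = (\<integral>x. (\<Sum>k\<le>n. (\<i> * y x) ^ k / fact k) * g x \<partial>M)"
      by (simp only: qy sum_distrib_right)
    finally have P: "poly P (of_real l) = (\<integral>x. (\<Sum>k\<le>n. (\<i> * y x) ^ k / fact k) * g x \<partial>M)" .
    have i1: "integrable M (\<lambda>x. iexp (y x) * g x)"
      unfolding y_def using integrable_iexp_mult[OF assms(1) g, of "l - c"] by simp
    have i2: "integrable M (\<lambda>x. (\<Sum>k\<le>n. (\<i> * y x) ^ k / fact k) * g x)"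
    proof -
      have "integrable M (\<lambda>x. \<Sum>k\<le>n. q k x * (of_real (l - c)) ^ k)"
        using q by (intro Bochner_Integration.integrable_sum integrable_mult_left) auto
      also have "(\<lambda>x. \<Sum>k\<le>n. q k x * (of_real (l - c)) ^ k) = (\<lambda>x. (\<Sum>k\<le>n. (\<i> * y x) ^ k / fact k) * g x)"
        by (simp only: qy sum_distrib_right)
      finally show ?thesis .
    qed
    have "fourier_along M r h l - poly P (of_real l)
        = (\<integral>x. iexp (y x) * g x - (\<Sum>k\<le>n. (\<i> * y x) ^ k / fact k) * g x \<partial>M)"
      unfolding F P by (rule Bochner_Integration.integral_diff[symmetric, OF i1 i2])
    also have "norm \<dots> \<le> (\<integral>x. (a * \<bar>l - c\<bar>) ^ Suc n / fact (Suc n) * norm (h x) \<partial>M)"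
    proof (rule order.trans[OF integral_norm_bound integral_mono])
      show "integrable M (\<lambda>x. norm (iexp (y x) * g x - (\<Sum>k\<le>n. (\<i> * y x) ^ k / fact k) * g x))"
        using i1 i2 by (intro integrable_norm Bochner_Integration.integrable_diff)
      show "integrable M (\<lambda>x. (a * \<bar>l - c\<bar>) ^ Suc n / fact (Suc n) * norm (h x))"
        using h by simp
      fix x
      show "norm (iexp (y x) * g x - (\<Sum>k\<le>n. (\<i> * y x) ^ k / fact k) * g x)
          \<le> (a * \<bar>l - c\<bar>) ^ Suc n / fact (Suc n) * norm (h x)"
      proof (cases "h x = 0")
        case False
        have "\<bar>y x\<bar> \<le> a * \<bar>l - c\<bar>"
          using supp[OF False] by (simp add: y_def abs_mult mult.commute[of "\<bar>l - c\<bar>"] mult_right_mono)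
        then have "norm (iexp (y x) - (\<Sum>k\<le>n. (\<i> * y x) ^ k / fact k)) \<le> (a * \<bar>l - c\<bar>) ^ Suc n / fact (Suc n)"
          by (intro order.trans[OF iexp_approx1] divide_right_mono power_mono) auto
        then show ?thesis
          by (simp only: left_diff_distrib[symmetric] norm_mult ng mult_right_mono norm_ge_zero)
      qed (simp add: g_def)
    qed
    also have "\<dots> = (a * \<bar>l - c\<bar>) ^ Suc n / fact (Suc n) * (\<integral>x. norm (h x) \<partial>M)" by simp
    also have "\<dots> \<le> (a * \<bar>l - c\<bar>) ^ Suc n / fact (Suc n) * 1"
      using h1 a by (intro mult_left_mono) auto
    finally show ?thesis by simp
  qed
  ultimately show ?thesis using that[of P] by simp
qed

text \<open>
  Truncating the measure to \<open>\<bar>r\<bar> < a\<close> changes the transform by at most \<open>exp (- s)\<close>, and on a window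
  of length \<open>d\<close> the truncated transform is a polynomial of degree below \<open>n \<approx> s / 8\<close> up to \<open>exp (- 8 n)\<close>,
  because \<open>a d\<close> is a small multiple of \<open>n\<close>. The loss \<open>exp (4 n)\<close> in the Remez inequality is affordable.
\<close>

lemma fourier_along_smallness_spreads:
  fixes r :: "'a \<Rightarrow> real"
  assumes [measurable]: "r \<in> borel_measurable M" and h: "integrable M h"
    and h1: "(\<integral>x. norm (h x) \<partial>M) \<le> 1"
    and tail: "(\<integral>x. indicator {x. a \<le> \<bar>r x\<bar>} x * norm (h x) \<partial>M) \<le> exp (- s)"
    and s: "16 \<le> s" and a: "0 < a" and d: "0 < d" "160000 * (a * d) \<le> s"
    and G: "d / 2 \<le> measure lborel {l \<in> {t..t + d}. norm (fourier_along M r h l) \<le> exp (- s)}"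
    and z: "z \<in> {t..t + d}"
  shows "norm (fourier_along M r h z) \<le> exp (- s / 16)"
proof -
  define F where "F = fourier_along M r h"
  have [measurable]: "h \<in> borel_measurable M" using h by simp
  \<comment> \<open>\<open>n <= s / 8\<close> makes the truncation error \<open>exp (- s)\<close> no
    larger than \<open>exp (- 8 n)\<close>; \<open>s / 16 <= n\<close> gives
    \<open>a * d <= n / 10000\<close>.\<close>
  define n where "n = nat \<lfloor>s / 8\<rfloor>"
  have n: "8 * real n \<le> s" "s / 16 \<le> real n" "n \<noteq> 0"
    unfolding n_def using s by linarith+
  obtain m where m: "n = Suc m" using n(3) not0_implies_Suc by blast
  define h0 where "h0 x = indicator {x. \<bar>r x\<bar> < a} x * h x" for x
  have [measurable]: "h0 \<in> borel_measurable M" unfolding h0_def by measurable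
  have h0: "integrable M h0"
    by (rule Bochner_Integration.integrable_bound[OF h]) (auto simp: h0_def indicator_def)
  have "(\<integral>x. norm (h0 x) \<partial>M) \<le> (\<integral>x. norm (h x) \<partial>M)"
    by (intro integral_mono integrable_norm h h0) (auto simp: h0_def indicator_def)
  then have h01: "(\<integral>x. norm (h0 x) \<partial>M) \<le> 1" using h1 by simp
  have trunc: "norm (F l - fourier_along M r h0 l) \<le> exp (- s)" for l
  proof -
    have "F l - fourier_along M r h0 l = (\<integral>x. iexp (- (l * r x)) * h x - iexp (- (l * r x)) * h0 x \<partial>M)"
      unfolding F_def fourier_along_def
      by (intro Bochner_Integration.integral_diff[symmetric] integrable_iexp_mult h h0) simp_all
    also have "\<dots> = fourier_along M r (\<lambda>x. h x - h0 x) l"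
      unfolding fourier_along_def by (simp add: right_diff_distrib)
    also have "norm \<dots> \<le> (\<integral>x. norm (h x - h0 x) \<partial>M)" by (rule norm_fourier_along_le)
    also have "\<dots> = (\<integral>x. indicator {x. a \<le> \<bar>r x\<bar>} x * norm (h x) \<partial>M)"
      by (intro Bochner_Integration.integral_cong) (auto simp: h0_def indicator_def)
    finally show ?thesis using tail by simp
  qed
  \<comment> \<open>Expanding about the midpoint halves the distance, so
    \<open>a * \<bar>l - c\<bar> <= n / 20000\<close> on the window.\<close>
  obtain P where P: "degree P < n"
    "\<And>l. norm (fourier_along M r h0 l - poly P (of_real l)) \<le> (a * \<bar>l - (t + d / 2)\<bar>) ^ n / fact n"
  proof (rule fourier_along_poly_approx[OF assms(1) h0 h01, of a m "t + d / 2", folded m])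
    show "\<bar>r x\<bar> \<le> a" if "h0 x \<noteq> 0" for x using that by (auto simp: h0_def indicator_def split: if_splits)
  qed (use a in auto)
  \<comment> \<open>Origin of the constant 160000: the Taylor error is at most
    \<open>(e / 20000) ^ n\<close>, and \<open>e ^ 9 <= 3 ^ 9 = 19683\<close> turns it into
    \<open>exp (- 8 n)\<close>.\<close>
  have "exp (9::real) \<le> 3 ^ 9"
    using power_mono[OF exp_le, of 9] exp_of_nat_mult[of 9 "1::real"] by simp
  then have e9: "exp (1::real) / 20000 \<le> exp (- 8)"
    using exp_add[of 1 "8::real"] by (simp add: exp_minus field_simps)
  have R: "norm (fourier_along M r h0 l - poly P (of_real l)) \<le> exp (- 8 * real n)" if "l \<in> {t..t + d}" for l
  proof -
    have "a * \<bar>l - (t + d / 2)\<bar> \<le> a * (d / 2)"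
      using a that by (intro mult_left_mono) (auto simp: abs_if)
    also have "\<dots> \<le> real n / 20000" using d n by simp
    finally have "(a * \<bar>l - (t + d / 2)\<bar>) ^ n / fact n \<le> (real n / 20000) ^ n / fact n"
      using a by (intro divide_right_mono power_mono) auto
    also have "\<dots> = (real n ^ n / fact n) / 20000 ^ n" by (simp add: power_divide)
    also have "\<dots> \<le> exp (real n) / 20000 ^ n"
      using power_self_le_exp_fact[of n] by (intro divide_right_mono) (auto simp: divide_simps)
    also have "\<dots> = (exp 1 / 20000) ^ n"
      using exp_of_nat_mult[of n "1::real"] by (simp add: power_divide)
    also have "\<dots> \<le> exp (- 8) ^ n" using e9 by (intro power_mono) auto
    also have "\<dots> = exp (- 8 * real n)" using exp_of_nat_mult[of n "- 8::real"] by (simp add: mult.commute)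
    finally show ?thesis using P(2)[of l] by linarith
  qed
  have es: "exp (- s) \<le> exp (- 8 * real n)" using n by simp
  have cont: "continuous_on UNIV F" unfolding F_def by (rule continuous_fourier_along[OF assms(1) h])
  define K where "K = {l \<in> {t..t + d}. norm (F l) \<le> exp (- s)}"
  have "closed {l. norm (F l) \<le> exp (- s)}"
    using cont by (intro closed_Collect_le continuous_intros) auto
  then have "K \<in> sets borel"
    unfolding K_def using closed_Int[of "{t..t+d}"] by (auto simp: Collect_conj_eq intro!: borel_closed)
  have "norm (poly P (of_real z)) \<le> exp (4 * real n) * (3 * exp (- 8 * real n))"
  proof (rule remez_inequality[OF P(1) \<open>K \<in> sets borel\<close> _ _ d(1) _ z])
    show "K \<subseteq> {t..t + d}" "d / 2 \<le> measure lborel K" using G by (auto simp: K_def F_def)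
    fix l assume "l \<in> K"
    then have l: "l \<in> {t..t + d}" "norm (F l) \<le> exp (- s)" by (auto simp: K_def)
    have "norm (poly P (of_real l)) \<le> norm (F l) + norm (F l - fourier_along M r h0 l)
        + norm (fourier_along M r h0 l - poly P (of_real l))" by norm
    then show "norm (poly P (of_real l)) \<le> 3 * exp (- 8 * real n)"
      using l trunc[of l] R[of l] es by linarith
  qed
  also have "\<dots> = 3 * exp (- 4 * real n)" by (simp flip: exp_add)
  finally have "norm (poly P (of_real z)) \<le> 3 * exp (- 4 * real n)" .
  moreover have "exp (- 8 * real n) \<le> exp (- 4 * real n)" by simp
  moreover have "norm (F z) \<le> norm (poly P (of_real z)) + norm (F z - fourier_along M r h0 z)
        + norm (fourier_along M r h0 z - poly P (of_real z))" by norm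
  ultimately have "norm (F z) \<le> 5 * exp (- 4 * real n)"
    using trunc[of z] R[OF z] es by linarith
  also have "\<dots> \<le> exp 3 * exp (- s / 4)"
  proof (rule mult_mono)
    show "(5::real) \<le> exp 3"
      using power_mono[OF exp_ge_add_one_self[of "1::real"], of 3] exp_of_nat_mult[of 3 "1::real"] by simp
  qed (use n in auto)
  \<comment> \<open>\<open>3 - s / 4 <= - s / 16\<close> is equivalent to the hypothesis
    \<open>16 <= s\<close>.\<close>
  also have "\<dots> \<le> exp (- s / 16)" using s by (simp flip: exp_add)
  finally show ?thesis by (simp add: F_def)
qed

subsection \<open>Propagation of smallness\<close>

text \<open>Moving a window admits new points only from a strip \<open>N\<close> whose length is the
  shift.\<close>

lemma measure_window_lipschitz:
  fixes B :: "real set"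
  assumes [measurable]: "B \<in> sets borel"
  shows "measure lborel (B \<inter> {t..t + d}) \<le> measure lborel (B \<inter> {s..s + d}) + \<bar>t - s\<bar>"
proof -
  define N where "N = (if s \<le> t then {s + d..t + d} else {t..s})"
  have "B \<inter> {t..t + d} \<subseteq> (B \<inter> {s..s + d}) \<union> N" by (auto simp: N_def)
  moreover have "N \<in> sets borel" "measure lborel N = \<bar>t - s\<bar>" by (auto simp: N_def)
  moreover have "(B \<inter> {s..s + d}) \<union> N \<in> fmeasurable lborel"
    by (rule fmeasurable.Un) (auto simp: N_def intro: fmeasurable_lborel_Icc)
  ultimately have "measure lborel (B \<inter> {t..t + d}) \<le> measure lborel ((B \<inter> {s..s + d}) \<union> N)"
    by (intro measure_mono_fmeasurable) auto
  also have "\<dots> \<le> measure lborel (B \<inter> {s..s + d}) + measure lborel N"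
    using \<open>N \<in> sets borel\<close> by (intro measure_Un_le) auto
  finally show ?thesis using \<open>measure lborel N = \<bar>t - s\<bar>\<close> by simp
qed

text \<open>The filled part of a window is a 1-Lipschitz function of its position.\<close>

lemma window_intermediate_value:
  fixes B :: "real set"
  assumes B: "B \<in> sets borel" and t: "t0 \<in> {a..b}" "t1 \<in> {a..b}"
    and "measure lborel (B \<inter> {t0..t0 + d}) \<le> c" "c \<le> measure lborel (B \<inter> {t1..t1 + d})"
  obtains t where "t \<in> {a..b}" "measure lborel (B \<inter> {t..t + d}) = c"
proof -
  define D where "D t = measure lborel (B \<inter> {t..t + d})" for t
  have "1-lipschitz_on UNIV D"
  proof (rule lipschitz_onI)
    fix x y show "dist (D x) (D y) \<le> 1 * dist x y"
      using measure_window_lipschitz[OF B, of x d y] measure_window_lipschitz[OF B, of y d x]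
      by (simp add: D_def dist_real_def abs_minus_commute)
  qed simp
  then have "continuous_on UNIV D" by (rule lipschitz_on_continuous_on)
  then have "connected (D ` {a..b})"
    by (intro connected_continuous_image) (auto intro: continuous_on_subset)
  then have "{D t0..D t1} \<subseteq> D ` {a..b}" using t by (intro connected_contains_Icc) auto
  then have "c \<in> D ` {a..b}" using assms(4,5) by (auto simp: D_def)
  then show thesis using that by (auto simp: D_def)
qed

text \<open>
  While the set \<open>B k\<close> where \<open>F\<close> exceeds \<open>eps k\<close> is nonempty, some window of length \<open>d k\<close> is at least
  half filled by \<open>B (Suc k)\<close> (near a point of \<open>B k\<close>) and another one at most half filled (near \<open>Z\<close>). A window
  filled exactly by half is disjoint from \<open>B k\<close>, so \<open>B k\<close> is smaller than \<open>B (Suc k)\<close> by \<open>d k / 2\<close>.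
\<close>

lemma quasianalytic_propagation:
  fixes F :: "real \<Rightarrow> complex" and Z :: "real set"
  assumes cont: "continuous_on UNIV F"
    and eps: "antimono eps" "eps \<longlonglongrightarrow> 0" "\<And>k. 0 \<le> eps k"
    and d: "\<And>k. 0 < d k" "\<And>k. d k \<le> w" "\<not> summable d" and w: "w \<le> 2 * R"
    and Z: "Z \<in> sets borel" "\<And>l. l \<in> Z \<Longrightarrow> F l = 0"
    and dense: "\<And>u. 0 < u \<Longrightarrow> u \<le> w \<Longrightarrow> \<exists>t. - R \<le> t \<and> t + u \<le> R \<and> u / 2 \<le> measure lborel (Z \<inter> {t..t + u})"
    and spread: "\<And>k t z. d k / 2 \<le> measure lborel {l \<in> {t..t + d k}. norm (F l) \<le> eps (Suc k)} \<Longrightarrow>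
      z \<in> {t..t + d k} \<Longrightarrow> norm (F z) \<le> eps k"
    and l: "l \<in> {- R..R}"
  shows "F l = 0"
proof -
  define B where "B k = {x \<in> {- R..R}. eps k < norm (F x)}" for k
  have "open {x. eps k < norm (F x)}" for k
    using cont by (intro open_Collect_less continuous_intros) auto
  then have Bm: "B k \<in> sets borel" for k
    by (auto simp: B_def Collect_conj_eq borel_open)
  have Bf: "B k \<in> fmeasurable lborel" for k
    using Bm by (rule fmeasurable_lborel_Icc[of _ "-R" R]) (auto simp: B_def)
  have Bmono: "B j \<subseteq> B k" if "j \<le> k" for j k
    using antimonoD[OF eps(1) that] by (auto simp: B_def)
  have compl: "measure lborel {l \<in> {t..t + u}. norm (F l) \<le> eps k} = u - measure lborel (B k \<inter> {t..t + u})"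
    if "- R \<le> t" "t + u \<le> R" "0 < u" for t u k
  proof -
    have "{l \<in> {t..t + u}. norm (F l) \<le> eps k} = {t..t + u} - (B k \<inter> {t..t + u})"
      using that by (auto simp: B_def)
    also have "measure lborel \<dots> = measure lborel {t..t + u} - measure lborel (B k \<inter> {t..t + u})"
      using Bm that by (intro measure_Diff) auto
    finally show ?thesis using that by simp
  qed
  have step: "measure lborel (B k) + d k / 2 \<le> measure lborel (B (Suc k))" if ne: "B k \<noteq> {}" for k
  proof -
    from ne obtain x where x: "x \<in> {- R..R}" "eps k < norm (F x)" by (auto simp: B_def)
    obtain t0 where t0: "- R \<le> t0" "t0 + d k \<le> R" "d k / 2 \<le> measure lborel (Z \<inter> {t0..t0 + d k})"
      using dense[of "d k"] d by auto
    \<comment> \<open>A window that contains \<open>x\<close> and does not leave the interval; near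
      the right end it is pushed back, which is possible since
      \<open>d k <= w <= 2 * R\<close>.\<close>
    define t1 where "t1 = (if x + d k \<le> R then x else R - d k)"
    have t1: "- R \<le> t1" "t1 + d k \<le> R" "x \<in> {t1..t1 + d k}"
      using x d(1)[of k] d(2)[of k] w by (auto simp: t1_def)
    have "measure lborel {l \<in> {t1..t1 + d k}. norm (F l) \<le> eps (Suc k)} < d k / 2"
      using spread[of k t1 x] t1 x by (meson not_less)
    then have u1: "d k / 2 \<le> measure lborel (B (Suc k) \<inter> {t1..t1 + d k})"
      using compl[OF t1(1,2) d(1)] by simp
    have "measure lborel (Z \<inter> {t0..t0 + d k}) \<le> measure lborel {l \<in> {t0..t0 + d k}. norm (F l) \<le> eps (Suc k)}"
    proof (rule measure_mono_fmeasurable)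
      have "closed {x. norm (F x) \<le> eps (Suc k)}"
        using cont by (intro closed_Collect_le continuous_intros) auto
      then have "{l \<in> {t0..t0 + d k}. norm (F l) \<le> eps (Suc k)} \<in> sets borel"
        by (auto simp: Collect_conj_eq borel_closed)
      then show "{l \<in> {t0..t0 + d k}. norm (F l) \<le> eps (Suc k)} \<in> fmeasurable lborel"
        by (rule fmeasurable_lborel_Icc[of _ t0 "t0 + d k"]) auto
    qed (use Z eps(3) in auto)
    then have u0: "measure lborel (B (Suc k) \<inter> {t0..t0 + d k}) \<le> d k / 2"
      using t0(3) compl[OF t0(1,2) d(1), of "Suc k"] by simp
    obtain t where t: "t \<in> {- R..R - d k}" "measure lborel (B (Suc k) \<inter> {t..t + d k}) = d k / 2"
      by (rule window_intermediate_value[OF Bm, of t0 "- R" "R - d k" t1 "Suc k" "d k" "d k / 2"])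
        (use t0 t1 u0 u1 in auto)
    have t': "- R \<le> t" "t + d k \<le> R" using t by auto
    have "d k / 2 \<le> measure lborel {l \<in> {t..t + d k}. norm (F l) \<le> eps (Suc k)}"
      using t(2) compl[OF t' d(1)] by simp
    from spread[OF this] have disj: "B k \<inter> (B (Suc k) \<inter> {t..t + d k}) = {}"
      by (force simp: B_def)
    have "measure lborel (B k) + d k / 2 = measure lborel (B k \<union> (B (Suc k) \<inter> {t..t + d k}))"
      using t(2) disj Bm Bf[of k] Bf[of "Suc k"]
      by (subst measure_Un3) (auto intro: fmeasurable_Int_fmeasurable)
    also have "\<dots> \<le> measure lborel (B (Suc k))"
      using Bmono[of k "Suc k"] Bm Bf by (intro measure_mono_fmeasurable) auto
    finally show ?thesis .
  qed
  have "B k = {}" for k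
  proof (rule ccontr)
    \<comment> \<open>The sets increase with the index, so all later ones are nonempty as well and
      \<open>step\<close> applies to each of them. The gains would add up without bound inside an
      interval of length \<open>2 * R\<close>.\<close>
    assume ne: "B k \<noteq> {}"
    have sum: "(\<Sum>i<n. d (i + k)) / 2 \<le> measure lborel (B (n + k))" for n
    proof (induction n)
      case (Suc n)
      have "B (n + k) \<noteq> {}" using ne Bmono[of k "n + k"] by auto
      from step[OF this] Suc show ?case by (simp add: add_divide_distrib)
    qed simp
    have "(\<Sum>i<n. d (i + k)) \<le> 4 * R" for n
    proof -
      have "measure lborel (B (n + k)) \<le> measure lborel {- R..R}"
        using Bm by (intro measure_mono_fmeasurable) (auto simp: B_def intro: fmeasurable_lborel_Icc)
      then show ?thesis using sum[of n] l by auto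
    qed
    then have "summable (\<lambda>i. d (i + k))"
      using d(1) by (intro summableI_nonneg_bounded) (auto simp: less_imp_le)
    then show False using d(3) by (simp add: summable_iff_shift)
  qed
  then have "norm (F l) \<le> eps k" for k
    using l by (force simp: B_def not_less)
  then have "norm (F l) \<le> 0" using eps(2) by (intro LIMSEQ_le_const) auto
  then show ?thesis by simp
qed

section \<open>Half-filled windows at every small scale\<close>

text \<open>A covering argument in place of a density point. Enclose a compact part \<open>C\<close>
  of \<open>E\<close> in an open \<open>U\<close> of less than twice its measure, and cut the line
  into cells of length \<open>u\<close>. The cells that meet \<open>C\<close> lie in
  \<open>U\<close> if \<open>u\<close> is small. If \<open>C\<close> filled at most half of each of
  them, its measure would be at most half that of \<open>U\<close>.\<close>

lemma positive_measure_dense_windows: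
  fixes E :: "real set"
  assumes E: "closed E" "0 < emeasure lborel E"
  obtains w R0 where "0 < w"
    "\<And>u R. 0 < u \<Longrightarrow> u \<le> w \<Longrightarrow> R0 \<le> R \<Longrightarrow> \<exists>t. - R \<le> t \<and> t + u \<le> R \<and> u / 2 \<le> measure lborel (E \<inter> {t..t + u})"
proof -
  have "\<exists>N. emeasure lborel (E \<inter> {- real N..real N}) \<noteq> 0"
  proof (rule ccontr)
    assume "\<not> ?thesis"
    then have "emeasure lborel (\<Union>N. E \<inter> {- real N..real N}) = 0"
      using E(1) by (intro emeasure_UN_eq_0) auto
    moreover have "(\<Union>N. E \<inter> {- real N..real N}) = E"
    proof -
      have "\<exists>N. x \<in> {- real N..real N}" for x
        using real_arch_simple[of "\<bar>x\<bar>"] by (auto simp: abs_le_iff minus_le_iff)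
      then show ?thesis by auto
    qed
    ultimately show False using E(2) by simp
  qed
  then obtain N :: nat where N: "emeasure lborel (E \<inter> {- real N..real N}) \<noteq> 0" by blast
  define C where "C = E \<inter> {- real N..real N}"
  have C: "compact C" unfolding C_def using E(1) by (intro closed_Int_compact) auto
  then have Cb[measurable]: "C \<in> sets borel" by (simp add: borel_compact)
  define m where "m = measure lborel C"
  have em: "emeasure lborel C = ennreal m"
    unfolding m_def using emeasure_compact_finite[OF C] by (intro emeasure_eq_ennreal_measure) auto
  then have m: "m > 0" using N by (auto simp: C_def m_def zero_less_measure_iff)
  obtain U where U: "open U" "C \<subseteq> U" "emeasure lborel (U - C) < m"
    using outer_regular_lborel[OF Cb, of m] m by auto
  have Um: "emeasure lborel U < ennreal (2 * m)"
  proof -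
    have "emeasure lborel U = emeasure lborel C + emeasure lborel (U - C)"
      using U by (subst plus_emeasure) (auto intro!: arg_cong[where f = "emeasure lborel"])
    also have "\<dots> < ennreal m + ennreal m"
      using U em m by (simp add: ennreal_add_left_cancel_less)
    finally show ?thesis using m by (simp flip: ennreal_plus)
  qed
  have "C \<noteq> {}" using N by (auto simp: C_def)
  obtain w0 where w0: "0 < w0" "(\<Union>x\<in>C. ball x w0) \<subseteq> U"
    using compact_subset_open_imp_ball_epsilon_subset[OF C U(1,2)] by blast
  \<comment> \<open>\<open>w < w0\<close> keeps the cells inside \<open>U\<close>;
    \<open>w <= 1\<close> keeps them inside \<open>[- N - 1, N + 1]\<close>, whence the bound on
    \<open>R\<close>.\<close>
  define w where "w = min 1 (w0 / 2)"
  have w: "0 < w" "w \<le> 1" "w < w0" using w0 by (auto simp: w_def)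
  have "\<exists>t. - R \<le> t \<and> t + u \<le> R \<and> u / 2 \<le> measure lborel (E \<inter> {t..t + u})"
    if u: "0 < u" "u \<le> w" and R: "real N + 1 \<le> R" for u R
  proof (rule ccontr)
    assume none: "\<not> ?thesis"
    define J where "J = (\<lambda>x. \<lfloor>x / u\<rfloor>) ` C"
    define I where "I j = {of_int j * u..<of_int j * u + u}" for j :: int
    have inI: "x \<in> I \<lfloor>x / u\<rfloor>" for x
      using floor_divide_lower[OF u(1), of x] floor_divide_upper[OF u(1), of x]
      by (simp add: I_def distrib_right)
    have "J \<subseteq> {\<lfloor>- real N / u\<rfloor>..\<lfloor>real N / u\<rfloor>}"
    proof -
      have "\<lfloor>- real N / u\<rfloor> \<le> \<lfloor>x / u\<rfloor>" "\<lfloor>x / u\<rfloor> \<le> \<lfloor>real N / u\<rfloor>" if "x \<in> C" for x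
        using that u by (intro floor_mono divide_right_mono; simp add: C_def)+
      then show ?thesis by (auto simp: J_def)
    qed
    then have finJ: "finite J" by (rule finite_subset) simp
    have small: "measure lborel (C \<inter> I j) \<le> u / 2" and IU: "I j \<subseteq> U" if "j \<in> J" for j
    proof -
      from that obtain x where x: "x \<in> C" "j = \<lfloor>x / u\<rfloor>" by (auto simp: J_def)
      have xI: "x \<in> I j" using inI x by simp
      have "x \<in> {- real N..real N}" using x by (simp add: C_def)
      then have "- R \<le> of_int j * u" "of_int j * u + u \<le> R"
        using xI u w R unfolding I_def by auto
      then have "measure lborel (E \<inter> {of_int j * u..of_int j * u + u}) < u / 2"
        using none by (meson not_less)
      moreover have "measure lborel (C \<inter> I j) \<le> measure lborel (E \<inter> {of_int j * u..of_int j * u + u})"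
        using E(1) by (intro measure_mono_fmeasurable)
          (auto simp: C_def I_def intro: fmeasurable_lborel_Icc)
      ultimately show "measure lborel (C \<inter> I j) \<le> u / 2" by simp
      have "I j \<subseteq> ball x w0" using xI u w by (auto simp: I_def dist_real_def)
      then show "I j \<subseteq> U" using w0(2) x by auto
    qed
    have "disjoint_family_on I J"
      unfolding disjoint_family_on_def
    proof (intro ballI impI)
      fix i j assume "i \<in> J" "j \<in> J" "i \<noteq> j"
      have "x \<notin> I i \<inter> I j" for x
      proof
        assume "x \<in> I i \<inter> I j"
        then have "\<lfloor>x / u\<rfloor> = i" "\<lfloor>x / u\<rfloor> = j"
          using u by (auto simp: I_def floor_eq_iff field_simps)
        then show False using \<open>i \<noteq> j\<close> by simp
      qed
      then show "I i \<inter> I j = {}" by blast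
    qed
    then have "ennreal (real (card J) * u) = emeasure lborel (\<Union>j\<in>J. I j)"
      using finJ u by (subst sum_emeasure[symmetric]) (auto simp: I_def image_subset_iff ennreal_mult' ennreal_of_nat_eq_real_of_nat)
    also have "\<dots> \<le> emeasure lborel U" using IU U(1) by (intro emeasure_mono) auto
    finally have "ennreal (real (card J) * u) < ennreal (2 * m)" using Um by simp
    then have "real (card J) * u < 2 * m" using u by (simp add: ennreal_less_iff)
    moreover have "m \<le> real (card J) * (u / 2)"
    proof -
      have "C = (\<Union>j\<in>J. C \<inter> I j)" using inI by (auto simp: J_def)
      then have "m = measure lborel (\<Union>j\<in>J. C \<inter> I j)" by (simp add: m_def)
      also have "\<dots> \<le> (\<Sum>j\<in>J. measure lborel (C \<inter> I j))"
        using finJ by (intro measure_UNION_le) (auto simp: I_def)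
      also have "\<dots> \<le> real (card J) * (u / 2)"
        using small by (intro sum_bounded_above) auto
      finally show ?thesis .
    qed
    ultimately show False by simp
  qed
  then show thesis using that w(1) by blast
qed

section \<open>Levels extracted from the logarithmic integral\<close>

text \<open>The weight dominates \<open>1 / (1 + x^2)\<close> for nonnegative \<open>x\<close>, and
  its tail from \<open>a - 1\<close> is exactly \<open>2 / a\<close>, the quantity that occurs in
  the window lengths.\<close>

lemma nn_integral_inverse_square_tail:
  fixes b :: real
  assumes "0 \<le> b"
  shows "(\<integral>\<^sup>+x. ennreal (2 / (1 + x)\<^sup>2) * indicator {b..} x \<partial>lborel) = ennreal (2 / (1 + b))"
proof -
  have "(\<integral>\<^sup>+x. ennreal (2 / (1 + x)\<^sup>2) * indicator {b..} x \<partial>lborel) = 0 - (- 2 / (1 + b))"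
  proof (rule nn_integral_FTC_atLeast)
    fix x :: real assume "b \<le> x"
    then show "DERIV (\<lambda>x. - 2 / (1 + x)) x :> 2 / (1 + x)\<^sup>2"
      using assms by (auto intro!: derivative_eq_intros simp: power2_eq_square)
  next
    show "((\<lambda>x::real. - 2 / (1 + x)) \<longlongrightarrow> 0) at_top" by real_asymp
  qed auto
  then show ?thesis by simp
qed

text \<open>Where \<open>\<phi>\<close> lies between \<open>16 ^ (k + m)\<close> and
  \<open>16 ^ Suc (k + m)\<close> one has \<open>a k - 1 <= x\<close>, so that part of the integral
  is at most \<open>32 * 16 ^ (k + m) / a k\<close>. Convergence of the series would make the
  integral finite.\<close>

lemma quasianalytic_levels:
  fixes \<phi> :: "real \<Rightarrow> real"
  assumes mono: "mono_on {0..} \<phi>"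
    and div: "(\<integral>\<^sup>+x\<in>{0..}. ennreal (\<phi> x / (1 + x\<^sup>2)) \<partial>lborel) = \<infinity>"
  obtains a :: "nat \<Rightarrow> real" and m where
    "\<And>k. 0 < a k" "\<And>k. 16 ^ (k + m) \<le> \<phi> (a k)" "\<not> summable (\<lambda>k. 16 ^ (k + m) / a k)"
proof -
  define w where "w x = 2 / (1 + x)\<^sup>2" for x :: real
  have [measurable]: "w \<in> borel_measurable borel" unfolding w_def by measurable
  have w: "0 \<le> w x" for x by (simp add: w_def)
  have wle: "\<phi> x / (1 + x\<^sup>2) \<le> C * w x" if "\<phi> x \<le> C" "0 \<le> C" "0 \<le> x" for x C
  proof -
    have "\<phi> x / (1 + x\<^sup>2) \<le> C / (1 + x\<^sup>2)" using that by (intro divide_right_mono) auto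
    also have "1 / (1 + x\<^sup>2) \<le> w x"
    proof -
      have "(1 + x)\<^sup>2 \<le> 2 * (1 + x\<^sup>2)" using zero_le_power2[of "1 - x"] by (simp add: power2_eq_square algebra_simps)
      moreover have "0 < (1 + x)\<^sup>2" "0 < 1 + x\<^sup>2" using that by (auto simp: add_pos_nonneg)
      ultimately show ?thesis by (simp add: w_def divide_simps)
    qed
    then have "C / (1 + x\<^sup>2) \<le> C * w x" using mult_left_mono[of "1 / (1 + x\<^sup>2)" "w x" C] that by simp
    finally show ?thesis .
  qed
  have bounded: False if "\<And>x. 0 \<le> x \<Longrightarrow> \<phi> x \<le> C" "0 \<le> C" for C
  proof -
    have "(\<integral>\<^sup>+x\<in>{0..}. ennreal (\<phi> x / (1 + x\<^sup>2)) \<partial>lborel) \<le> (\<integral>\<^sup>+x. ennreal C * (ennreal (w x) * indicator {0..} x) \<partial>lborel)"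
      using wle that by (intro nn_integral_mono) (auto simp: indicator_def w ennreal_leI simp flip: ennreal_mult)
    also have "\<dots> = ennreal C * ennreal (2 / (1 + 0))"
      by (subst nn_integral_cmult) (simp_all add: nn_integral_inverse_square_tail w_def del: div_by_1)
    also have "\<dots> < \<infinity>" by (simp add: ennreal_mult_less_top)
    finally show False using div by simp
  qed
  \<comment> \<open>Starting above \<open>\<phi> 1\<close> forces every level to be reached only
    beyond 1, so \<open>a k >= 1\<close>.\<close>
  obtain m where m: "\<phi> 1 < 16 ^ m" using real_arch_pow[of 16 "\<phi> 1"] by auto
  define S where "S k = {x. 0 \<le> x \<and> 16 ^ (k + m) \<le> \<phi> x}" for k
  have S1: "1 \<le> x" if "x \<in> S k" for x k
  proof (rule ccontr)
    assume "\<not> 1 \<le> x"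
    then have "\<phi> x \<le> \<phi> 1" using that by (intro mono_onD[OF mono]) (auto simp: S_def)
    moreover have "(16::real) ^ m \<le> 16 ^ (k + m)" by (intro power_increasing) auto
    ultimately show False using that m unfolding S_def mem_Collect_eq by linarith
  qed
  \<comment> \<open>Without continuity the first point at a level may not exist; a point at most 1
    beyond the infimum serves instead. \<open>S k\<close> is nonempty because a bounded
    \<open>\<phi>\<close> has a convergent integral.\<close>
  have "\<exists>x\<in>S k. \<forall>y\<in>S k. x - 1 \<le> y" for k
  proof -
    have "S k \<noteq> {}" using bounded[of "16 ^ (k + m)"] by (force simp: S_def)
    moreover have bdd: "bdd_below (S k)" using S1 by (intro bdd_belowI)
    ultimately obtain x where "x \<in> S k" "x < Inf (S k) + 1" using cInf_lessD[of "S k" "Inf (S k) + 1"] by auto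
    then show ?thesis using cInf_lower[OF _ bdd] by (intro bexI[of _ x]) force+
  qed
  then obtain a where a: "\<And>k. a k \<in> S k" "\<And>k y. y \<in> S k \<Longrightarrow> a k - 1 \<le> y" by metis
  have "\<not> summable (\<lambda>k. 16 ^ (k + m) / a k)"
  proof
    assume sum: "summable (\<lambda>k. 16 ^ (k + m) / a k)"
    \<comment> \<open>\<open>g k\<close> majorises the integrand on the part between two consecutive
      levels, \<open>g0\<close> on the part below the lowest level.\<close>
    define g where "g k x = ennreal (16 ^ Suc (k + m)) * (ennreal (w x) * indicator {a k - 1..} x)" for k x
    define g0 where "g0 x = ennreal (16 ^ m) * (ennreal (w x) * indicator {0..} x)" for x
    have G0: "(\<integral>\<^sup>+x. g0 x \<partial>lborel) = ennreal (16 ^ m) * ennreal (2 / (1 + 0))"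
      unfolding g0_def
      by (subst nn_integral_cmult) (simp_all add: nn_integral_inverse_square_tail w_def del: div_by_1)
    have G: "(\<integral>\<^sup>+x. g k x \<partial>lborel) = ennreal (32 * (16 ^ (k + m) / a k))" for k
    proof -
      have "(\<integral>\<^sup>+x. g k x \<partial>lborel) = ennreal (16 ^ Suc (k + m)) * ennreal (2 / (1 + (a k - 1)))"
        unfolding g_def using S1[OF a(1)[of k]] nn_integral_inverse_square_tail[of "a k - 1"]
        by (subst nn_integral_cmult) (simp_all only: w_def, simp_all)
      also have "\<dots> = ennreal (16 ^ Suc (k + m) * (2 / (1 + (a k - 1))))"
        using S1[OF a(1)[of k]] by (intro ennreal_mult[symmetric]) auto
      finally show ?thesis by simp
    qed
    have "ennreal (\<phi> x / (1 + x\<^sup>2)) * indicator {0..} x \<le> g0 x + (\<Sum>k. g k x)" for x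
    proof (cases "0 \<le> x")
      case True
      show ?thesis
      proof (cases "\<phi> x < 16 ^ m")
        case less: True
        then have "ennreal (\<phi> x / (1 + x\<^sup>2)) \<le> g0 x"
          using wle[of x "16 ^ m"] \<open>0 \<le> x\<close> by (auto simp: g0_def ennreal_leI w simp flip: ennreal_mult)
        then show ?thesis using True by (simp add: add_increasing2)
      next
        case False
        obtain j where "\<phi> x < 16 ^ j" using real_arch_pow[of 16 "\<phi> x"] by auto
        moreover have "(16::real) ^ j \<le> 16 ^ (j + m)" by (intro power_increasing) auto
        ultimately have j: "\<phi> x < 16 ^ (j + m)" by linarith
        define J where "J = (LEAST j. \<phi> x < 16 ^ (j + m))"
        have J: "\<phi> x < 16 ^ (J + m)" unfolding J_def by (rule LeastI) (rule j)
        then obtain k where k: "J = Suc k" using False by (cases J) auto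
        have xk: "16 ^ (k + m) \<le> \<phi> x"
          using not_less_Least[of k "\<lambda>j. \<phi> x < 16 ^ (j + m)"] k unfolding J_def by simp
        then have "a k - 1 \<le> x" using a(2)[of x k] True by (simp add: S_def)
        moreover have "\<phi> x / (1 + x\<^sup>2) \<le> 16 ^ Suc (k + m) * w x"
          using J k True by (intro wle) auto
        ultimately have "ennreal (\<phi> x / (1 + x\<^sup>2)) \<le> g k x"
          by (auto simp: g_def w ennreal_leI simp flip: ennreal_mult simp del: power_Suc)
        also have "\<dots> \<le> (\<Sum>k. g k x)" using sum_le_suminf[of "\<lambda>k. g k x" "{k}"] by simp
        finally show ?thesis using True by (simp add: add_increasing)
      qed
    qed simp
    then have "(\<integral>\<^sup>+x\<in>{0..}. ennreal (\<phi> x / (1 + x\<^sup>2)) \<partial>lborel) \<le> (\<integral>\<^sup>+x. g0 x + (\<Sum>k. g k x) \<partial>lborel)"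
      by (intro nn_integral_mono)
    also have "\<dots> = (\<integral>\<^sup>+x. g0 x \<partial>lborel) + (\<Sum>k. \<integral>\<^sup>+x. g k x \<partial>lborel)"
      unfolding g0_def g_def by (subst nn_integral_add) (auto simp: nn_integral_suminf)
    also have "\<dots> = ennreal (16 ^ m) * ennreal (2 / (1 + 0)) + (\<Sum>k. ennreal (32 * (16 ^ (k + m) / a k)))"
      by (simp only: G0 G)
    also have "\<dots> < \<infinity>"
    proof -
      have "0 < a k" for k using S1[OF a(1)[of k]] by simp
      then have "(\<Sum>k. ennreal (32 * (16 ^ (k + m) / a k))) \<noteq> top"
        using summable_mult[OF sum, of 32] by (intro ennreal_suminf_neq_top) (auto simp: less_imp_le)
      then show ?thesis by (simp add: less_top ennreal_mult_less_top)
    qed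
    finally show False using div by simp
  qed
  moreover have "0 < a k" "16 ^ (k + m) \<le> \<phi> (a k)" for k
    using a(1)[of k] S1[OF a(1)[of k]] by (auto simp: S_def)
  ultimately show thesis using that by blast
qed

text \<open>If the capped series converged, its terms would tend to 0 and the cap would eventually
  be inactive. This allows the window lengths to be limited by \<open>w\<close>.\<close>

lemma not_summable_min:
  fixes x :: "nat \<Rightarrow> real"
  assumes "\<not> summable x" "0 < w"
  shows "\<not> summable (\<lambda>k. min w (x k))"
proof
  assume s: "summable (\<lambda>k. min w (x k))"
  then have "(\<lambda>k. min w (x k)) \<longlonglongrightarrow> 0" by (rule summable_LIMSEQ_zero)
  then have "eventually (\<lambda>k. min w (x k) < w) sequentially" using assms(2) by (rule order_tendstoD)
  then have "eventually (\<lambda>k. min w (x k) = x k) sequentially" by eventually_elim auto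
  then have "summable x" using s by (simp add: summable_cong)
  then show False using assms(1) by simp
qed

section \<open>The one-dimensional uniqueness theorem\<close>

theorem fourier_along_eq_0_of_positive_measure:
  fixes r :: "'a \<Rightarrow> real" and \<phi> :: "real \<Rightarrow> real"
  assumes r: "r \<in> borel_measurable M" and h: "integrable M h"
    and \<phi>: "\<And>x. 0 \<le> x \<Longrightarrow> 0 \<le> \<phi> x" "mono_on {0..} \<phi>"
      "(\<integral>\<^sup>+x\<in>{0..}. ennreal (\<phi> x / (1 + x\<^sup>2)) \<partial>lborel) = \<infinity>"
    and tail: "\<And>a. 0 \<le> a \<Longrightarrow> (\<integral>x. indicator {x. a \<le> \<bar>r x\<bar>} x * norm (h x) \<partial>M) \<le> T * exp (- \<phi> a)"
    and E: "closed E" "0 < emeasure lborel E" "\<And>l. l \<in> E \<Longrightarrow> fourier_along M r h l = 0"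
  shows "fourier_along M r h l = 0"
proof -
  \<comment> \<open>Dividing by \<open>c\<close> turns the tail constant into 1; the tail at
    \<open>a = 0\<close> then bounds the total mass by 1.\<close>
  define c where "c = max T 1"
  have c: "0 < c" "T \<le> c" by (auto simp: c_def)
  define g where "g x = h x / of_real c" for x
  have g: "integrable M g" unfolding g_def using h by simp
  have Fg: "fourier_along M r g l = fourier_along M r h l / of_real c" for l
    by (simp add: fourier_along_def g_def)
  have tailg: "(\<integral>x. indicator {x. a \<le> \<bar>r x\<bar>} x * norm (g x) \<partial>M) \<le> exp (- \<phi> a)" if "0 \<le> a" for a
  proof -
    have "(\<integral>x. indicator {x. a \<le> \<bar>r x\<bar>} x * norm (g x) \<partial>M)
        = (\<integral>x. indicator {x. a \<le> \<bar>r x\<bar>} x * norm (h x) \<partial>M) / c"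
      using c by (simp add: g_def norm_divide)
    also have "\<dots> \<le> c * exp (- \<phi> a) / c"
      using c tail[OF that] mult_right_mono[OF c(2) exp_ge_zero, of "- \<phi> a"] by (intro divide_right_mono) linarith+
    finally show ?thesis using c by simp
  qed
  have g1: "(\<integral>x. norm (g x) \<partial>M) \<le> 1"
  proof -
    have "exp (- \<phi> 0) \<le> 1" using \<phi>(1)[of 0] by simp
    moreover have "(\<integral>x. norm (g x) \<partial>M) \<le> exp (- \<phi> 0)" using tailg[of 0] by simp
    ultimately show ?thesis by linarith
  qed
  obtain a :: "nat \<Rightarrow> real" and m where a:
    "\<And>k. 0 < a k" "\<And>k. 16 ^ (k + m) \<le> \<phi> (a k)" "\<not> summable (\<lambda>k. 16 ^ (k + m) / a k)"
    using quasianalytic_levels[OF \<phi>(2,3)] by blast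
  obtain w R0 where w: "0 < w"
    "\<And>u R. 0 < u \<Longrightarrow> u \<le> w \<Longrightarrow> R0 \<le> R \<Longrightarrow> \<exists>t. - R \<le> t \<and> t + u \<le> R \<and> u / 2 \<le> measure lborel (E \<inter> {t..t + u})"
    using positive_measure_dense_windows[OF E(1,2)] by blast
  \<comment> \<open>The interval is chosen last: large enough for the given \<open>l\<close>, for a
    window of length \<open>w\<close>, and for the part of \<open>E\<close> that fills the
    windows.\<close>
  define R where "R = max R0 (max w \<bar>l\<bar>)"
  define s where "s k = (16::real) ^ (k + m)" for k
  \<comment> \<open>The index is shifted since \<open>d k\<close> is the window on which smallness
    at level \<open>Suc k\<close> is converted into smallness at level \<open>k\<close>.\<close>
  define d where "d k = min w (s (Suc k) / a (Suc k) / 160000)" for k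
  define eps where "eps k = exp (- s k)" for k
  have s: "s (Suc k) / 16 = s k" "16 \<le> s (Suc k)" for k
    using power_increasing[of 1 "Suc k + m" "16::real"] by (auto simp: s_def)
  have "fourier_along M r g l = 0"
  proof (rule quasianalytic_propagation[where eps = eps and d = d and w = w and R = R and Z = E])
    show "continuous_on UNIV (fourier_along M r g)" by (rule continuous_fourier_along[OF r g])
    show "antimono eps"
      by (auto simp: antimono_def eps_def s_def intro!: power_increasing)
    have "filterlim (\<lambda>k. (16::real) ^ (k + m)) at_top sequentially"
    proof (rule filterlim_at_top_mono[OF filterlim_real_sequentially], intro always_eventually allI)
      fix k
      have "real k \<le> 2 ^ k" using of_nat_less_two_power[of k, where 'a = real] by simp
      also have "\<dots> \<le> 16 ^ k" by (intro power_mono) auto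
      also have "\<dots> \<le> (16::real) ^ (k + m)" by (intro power_increasing) auto
      finally show "real k \<le> 16 ^ (k + m)" .
    qed
    then show "eps \<longlonglongrightarrow> 0" unfolding eps_def s_def
      by (intro filterlim_compose[OF exp_at_bot] filterlim_compose[OF filterlim_uminus_at_bot_at_top])
    show "0 \<le> eps k" for k by (simp add: eps_def)
    show "0 < d k" for k using w(1) a(1)[of "Suc k"] by (simp add: d_def s_def)
    show "d k \<le> w" for k by (simp add: d_def)
    have "\<not> summable (\<lambda>k. s (Suc k) / a (Suc k) / 160000)"
      using a(3) summable_Suc_iff[of "\<lambda>k. s k / a k"]
      by (simp only: summable_divide_iff s_def) simp
    then show "\<not> summable d" unfolding d_def using w(1) by (rule not_summable_min)
    show "w \<le> 2 * R" using w(1) by (simp add: R_def)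
    show "E \<in> sets borel" using E(1) by (rule borel_closed)
    show "fourier_along M r g l = 0" if "l \<in> E" for l using E(3)[OF that] Fg by simp
    show "\<exists>t. - R \<le> t \<and> t + u \<le> R \<and> u / 2 \<le> measure lborel (E \<inter> {t..t + u})" if "0 < u" "u \<le> w" for u
      using w(2)[OF that] by (simp add: R_def)
    show "l \<in> {- R..R}" by (auto simp: R_def abs_le_iff max_def)
    fix k t z
    assume G: "d k / 2 \<le> measure lborel {l \<in> {t..t + d k}. norm (fourier_along M r g l) \<le> eps (Suc k)}"
      and z: "z \<in> {t..t + d k}"
    have "norm (fourier_along M r g z) \<le> exp (- s (Suc k) / 16)"
    proof (rule fourier_along_smallness_spreads[OF r g g1 _ s(2) a(1)[of "Suc k"] _ _ G[unfolded eps_def] z])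
      have "exp (- \<phi> (a (Suc k))) \<le> exp (- s (Suc k))" using a(2)[of "Suc k"] by (simp add: s_def)
      then show "(\<integral>x. indicator {x. a (Suc k) \<le> \<bar>r x\<bar>} x * norm (g x) \<partial>M) \<le> exp (- s (Suc k))"
        using tailg[of "a (Suc k)"] a(1)[of "Suc k"] by linarith
      show "0 < d k" using w(1) a(1)[of "Suc k"] by (simp add: d_def s_def)
      have "a (Suc k) * d k \<le> a (Suc k) * (s (Suc k) / a (Suc k) / 160000)"
        using a(1)[of "Suc k"] by (intro mult_left_mono) (auto simp: d_def)
      then show "160000 * (a (Suc k) * d k) \<le> s (Suc k)" using a(1)[of "Suc k"] by simp
    qed
    then show "norm (fourier_along M r g z) \<le> eps k" using s(1)[of k] by (simp add: eps_def)
  qed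
  then show ?thesis using Fg c by simp
qed

section \<open>Injectivity of the Fourier transform\<close>

text \<open>The positive and the negative part of \<open>g\<close> have equal mass, by frequency 0.
  Unless that mass is 0, both can be normalised to probability distributions of \<open>r\<close>
  with the same characteristic function, and Levy's uniqueness theorem applies.\<close>

lemma real_integral_indicator_eq_0_of_fourier:
  fixes r g :: "'a \<Rightarrow> real"
  assumes r[measurable]: "r \<in> borel_measurable M" and g: "integrable M g"
    and zero: "\<And>t. (\<integral>x. iexp (t * r x) * of_real (g x) \<partial>M) = 0"
    and A: "A \<in> sets borel"
  shows "(\<integral>x. indicator A (r x) * g x \<partial>M) = 0"
proof -
  have [measurable]: "g \<in> borel_measurable M" using g by simp
  \<comment> \<open>\<open>p 1\<close> and \<open>p (-1)\<close> are the positive and the negative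
    part; the sign parameter lets both be treated at once.\<close>
  define p where "p s x = max 0 (s * g x)" for s x
  have p[measurable]: "p s \<in> borel_measurable M" for s unfolding p_def by measurable
  have pi: "integrable M (p s)" for s unfolding p_def using g by auto
  have pd: "g x = p 1 x - p (-1) x" for x by (auto simp: p_def max_def)
  have ii: "integrable M (\<lambda>x. iexp (t * r x) * of_real (p s x))" for t s
    using integrable_iexp_mult[OF r, of "\<lambda>x. of_real (p s x)" "- t"] pi[of s] by simp
  have eq: "(\<integral>x. iexp (t * r x) * of_real (p 1 x) \<partial>M) = (\<integral>x. iexp (t * r x) * of_real (p (-1) x) \<partial>M)" for t
    using zero[of t] ii unfolding pd by (simp add: right_diff_distrib)
  define c where "c = (\<integral>x. p 1 x \<partial>M)"
  have c': "(\<integral>x. p (-1) x \<partial>M) = c" using eq[of 0] by (simp add: c_def)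
  have pn: "0 \<le> p s x" for s x by (simp add: p_def)
  have "0 \<le> c" unfolding c_def using pn by simp
  show ?thesis
  proof (cases "c = 0")
    case True
    have z: "AE x in M. p s x = 0" if "s = 1 \<or> s = -1" for s
      using that integral_nonneg_eq_0_iff_AE[OF pi[of s]] pn c' c_def True by auto
    have "AE x in M. p 1 x = 0" "AE x in M. p (-1) x = 0" using z[of 1] z[of "-1"] by auto
    then have "AE x in M. g x = 0" by eventually_elim (simp add: pd)
    then show ?thesis by (intro integral_eq_zero_AE) auto
  next
    case False
    then have c: "0 < c" using \<open>0 \<le> c\<close> by simp
    define N where "N s = distr (density M (\<lambda>x. ennreal (p s x / c))) borel r" for s
    have rd: "real_distribution (N s)" if "s = 1 \<or> s = -1" for s
    proof -
      have "emeasure (density M (\<lambda>x. ennreal (p s x / c))) (space M) = (\<integral>\<^sup>+x. ennreal (p s x / c) \<partial>M)"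
        by (simp add: emeasure_density)
      also have "\<dots> = ennreal (\<integral>x. p s x / c \<partial>M)"
        using pi pn c by (intro nn_integral_eq_integral) auto
      also have "\<dots> = 1" using that c c' c_def by auto
      finally have "prob_space (density M (\<lambda>x. ennreal (p s x / c)))"
        by (intro prob_spaceI) simp
      then show ?thesis unfolding N_def by (rule prob_space.real_distribution_distr) simp
    qed
    have int: "(\<integral>y. f y \<partial>N s) = (\<integral>x. (p s x / c) *\<^sub>R f (r x) \<partial>M)"
      if [measurable]: "f \<in> borel_measurable borel" for f :: "real \<Rightarrow> 'b::{banach, second_countable_topology}" and s
      unfolding N_def using pn c by (subst integral_distr) (auto simp: integral_density)
    have "char (N 1) = char (N (-1))"
    proof
      fix t
      have "char (N s) t = (\<integral>x. iexp (t * r x) * of_real (p s x) \<partial>M) / of_real c" for s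
        unfolding char_def by (subst int) (auto simp: scaleR_conv_of_real mult.commute)
      then show "char (N 1) t = char (N (-1)) t" using eq by simp
    qed
    then have N: "N 1 = N (-1)" using rd by (intro Levy_uniqueness) auto
    have ind: "integrable M (\<lambda>x. indicator A (r x) * p s x)" for s
      by (rule Bochner_Integration.integrable_bound[OF pi[of s]]) (use A in \<open>auto simp: indicator_def\<close>)
    have "(\<integral>y. indicator A y \<partial>N s) = (\<integral>x. indicator A (r x) * p s x \<partial>M) / c" for s
      using A by (subst int) (auto simp: mult.commute)
    then have "(\<integral>x. indicator A (r x) * p 1 x \<partial>M) = (\<integral>x. indicator A (r x) * p (-1) x \<partial>M)"
      using N c by (metis divide_cancel_right less_irrefl)
    then show ?thesis using ind unfolding pd by (simp add: right_diff_distrib)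
  qed
qed

text \<open>The transform of \<open>cnj h\<close> is the conjugate of that of \<open>h\<close> at
  the opposite frequency, so it vanishes too. Hence the real and the imaginary part of
  \<open>h\<close> both have transform 0.\<close>

lemma integral_indicator_eq_0_of_fourier:
  fixes r :: "'a \<Rightarrow> real"
  assumes r[measurable]: "r \<in> borel_measurable M" and h: "integrable M h"
    and zero: "\<And>l. fourier_along M r h l = 0" and A: "A \<in> sets borel"
  shows "(\<integral>x. indicator A (r x) * h x \<partial>M) = 0"
proof -
  have z1: "(\<integral>x. iexp (t * r x) * h x \<partial>M) = 0" for t
    using zero[of "- t"] by (simp add: fourier_along_def)
  have i1: "integrable M (\<lambda>x. iexp (t * r x) * h x)" for t
    using integrable_iexp_mult[OF r h, of "- t"] by simp
  have cnj: "(\<lambda>x. iexp (t * r x) * cnj (h x)) = (\<lambda>x. cnj (iexp (- t * r x) * h x))" for t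
    by (auto simp: exp_cnj)
  have i2: "integrable M (\<lambda>x. iexp (t * r x) * cnj (h x))" for t
    unfolding cnj using i1[of "- t"] by (rule integrable_cnj)
  have z2: "(\<integral>x. iexp (t * r x) * cnj (h x) \<partial>M) = 0" for t
    by (simp only: cnj Bochner_Integration.integral_cnj z1 complex_cnj_zero)
  have "(\<integral>x. iexp (t * r x) * of_real (Re (h x)) \<partial>M) = 0" for t
  proof -
    have "iexp (t * r x) * of_real (Re (h x)) = (iexp (t * r x) * h x + iexp (t * r x) * cnj (h x)) / 2" for x
      by (simp add: complex_add_cnj flip: distrib_left)
    then have "(\<integral>x. iexp (t * r x) * of_real (Re (h x)) \<partial>M)
        = (\<integral>x. (iexp (t * r x) * h x + iexp (t * r x) * cnj (h x)) / 2 \<partial>M)"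
      by (simp only:)
    also have "\<dots> = (\<integral>x. iexp (t * r x) * h x + iexp (t * r x) * cnj (h x) \<partial>M) / 2"
      by (rule integral_divide_zero)
    also have "\<dots> = 0"
      by (simp only: Bochner_Integration.integral_add[OF i1 i2] z1 z2 add_0 diff_0_right div_0)
    finally show ?thesis .
  qed
  from real_integral_indicator_eq_0_of_fourier[OF r _ this A] h
  have Re: "(\<integral>x. indicator A (r x) * Re (h x) \<partial>M) = 0" by simp
  have "(\<integral>x. iexp (t * r x) * of_real (Im (h x)) \<partial>M) = 0" for t
  proof -
    have "iexp (t * r x) * of_real (Im (h x)) = (iexp (t * r x) * h x - iexp (t * r x) * cnj (h x)) / (2 * \<i>)" for x
    proof -
      have "iexp (t * r x) * h x - iexp (t * r x) * cnj (h x) = iexp (t * r x) * of_real (Im (h x)) * (2 * \<i>)"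
        by (simp only: right_diff_distrib[symmetric] complex_diff_cnj) simp
      from this[symmetric] show ?thesis by (subst nonzero_eq_divide_eq) (simp, assumption)
    qed
    then have "(\<integral>x. iexp (t * r x) * of_real (Im (h x)) \<partial>M)
        = (\<integral>x. (iexp (t * r x) * h x - iexp (t * r x) * cnj (h x)) / (2 * \<i>) \<partial>M)"
      by (simp only:)
    also have "\<dots> = (\<integral>x. iexp (t * r x) * h x - iexp (t * r x) * cnj (h x) \<partial>M) / (2 * \<i>)"
      by (rule integral_divide_zero)
    also have "\<dots> = 0"
      by (simp only: Bochner_Integration.integral_diff[OF i1 i2] z1 z2 add_0 diff_0_right div_0)
    finally show ?thesis .
  qed
  from real_integral_indicator_eq_0_of_fourier[OF r _ this A] h
  have Im: "(\<integral>x. indicator A (r x) * Im (h x) \<partial>M) = 0" by simp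
  have ind: "integrable M (\<lambda>x. indicator A (r x) * h x)"
    by (rule Bochner_Integration.integrable_bound[OF h]) (use A h in \<open>auto simp: indicator_def\<close>)
  show ?thesis
  proof (rule complex_eqI)
    have "Re (indicator A (r x) * h x) = indicator A (r x) * Re (h x)" for x by (simp add: indicator_def)
    then show "Re (\<integral>x. indicator A (r x) * h x \<partial>M) = Re 0"
      unfolding integral_Re[OF ind, symmetric] using Re by (simp only: zero_complex.sel)
    have "Im (indicator A (r x) * h x) = indicator A (r x) * Im (h x)" for x by (simp add: indicator_def)
    then show "Im (\<integral>x. indicator A (r x) * h x \<partial>M) = Im 0"
      unfolding integral_Im[OF ind, symmetric] using Im by (simp only: zero_complex.sel)
  qed
qed

subsection \<open>Total variation and density of a complex measure\<close>

text \<open>Evaluates \<open>measure_of\<close> for set functions defined as suprema, where the two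
  inequalities have separate proofs: superadditivity gives monotonicity and then bounds the partial
  sums from above.\<close>

lemma emeasure_measure_of_superadditive:
  fixes m :: "'a set \<Rightarrow> ennreal"
  assumes empty: "m {} = 0"
    and super: "\<And>A B. A \<in> sets M \<Longrightarrow> B \<in> sets M \<Longrightarrow> A \<inter> B = {} \<Longrightarrow> m A + m B \<le> m (A \<union> B)"
    and sub: "\<And>A :: nat \<Rightarrow> 'a set. range A \<subseteq> sets M \<Longrightarrow> disjoint_family A \<Longrightarrow> m (\<Union>i. A i) \<le> (\<Sum>i. m (A i))"
    and E: "E \<in> sets M"
  shows "emeasure (measure_of (space M) (sets M) m) E = m E"
proof (rule emeasure_measure_of_sigma[OF sets.sigma_algebra_axioms _ _ E])
  show "positive (sets M) m" using empty by (simp add: positive_def)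
  show "countably_additive (sets M) m"
    unfolding countably_additive_def
  proof (intro allI impI)
    fix A :: "nat \<Rightarrow> 'a set" assume A: "range A \<subseteq> sets M" "disjoint_family A" "(\<Union>i. A i) \<in> sets M"
    have mono: "m X \<le> m Y" if "X \<in> sets M" "Y \<in> sets M" "X \<subseteq> Y" for X Y
    proof -
      have "m X \<le> m X + m (Y - X)" by simp
      also have "\<dots> \<le> m (X \<union> (Y - X))" using that by (intro super) auto
      also have "X \<union> (Y - X) = Y" using that by auto
      finally show ?thesis .
    qed
    have fin: "(\<Sum>i<n. m (A i)) \<le> m (\<Union>i<n. A i)" for n
    proof (induction n)
      case (Suc n)
      have "(\<Sum>i<Suc n. m (A i)) \<le> m (\<Union>i<n. A i) + m (A n)" using Suc by (simp add: add_right_mono)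
      also have "\<dots> \<le> m ((\<Union>i<n. A i) \<union> A n)"
      proof (rule super)
        have "A i \<inter> A n = {}" if "i < n" for i using A(2) that by (auto simp: disjoint_family_on_def)
        then show "(\<Union>i<n. A i) \<inter> A n = {}" by blast
        show "(\<Union>i<n. A i) \<in> sets M" using A(1) by (intro sets.finite_UN) auto
        show "A n \<in> sets M" using A(1) by auto
      qed
      also have "(\<Union>i<n. A i) \<union> A n = (\<Union>i<Suc n. A i)" by (auto simp: less_Suc_eq)
      finally show ?case .
    qed (simp add: empty)
    have "(\<Sum>i. m (A i)) \<le> m (\<Union>i. A i)"
    proof (rule suminf_le_const)
      fix n
      have "(\<Union>i<n. A i) \<in> sets M" using A(1) by (intro sets.finite_UN) auto
      then have "m (\<Union>i<n. A i) \<le> m (\<Union>i. A i)" using A(3) by (rule mono) auto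
      then show "(\<Sum>i<n. m (A i)) \<le> m (\<Union>i. A i)" by (rule order.trans[OF fin])
    qed simp
    then show "(\<Sum>i. m (A i)) = m (\<Union>i. A i)" using sub[OF A(1,2)] by (rule antisym)
  qed
qed

text \<open>The terms may be negative; \<open>ennreal\<close> truncates them to 0, which only
  enlarges the right-hand side.\<close>

lemma ennreal_le_suminf_of_sums:
  fixes f :: "nat \<Rightarrow> real"
  assumes "f sums s"
  shows "ennreal s \<le> (\<Sum>i. ennreal (f i))"
proof (rule LIMSEQ_le_const2)
  show "(\<lambda>n. ennreal (\<Sum>i<n. f i)) \<longlonglongrightarrow> ennreal s"
    using assms unfolding sums_def by (rule tendsto_ennrealI)
  have "ennreal (\<Sum>i<n. f i) \<le> (\<Sum>i. ennreal (f i))" for n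
  proof -
    have "ennreal (\<Sum>i<n. f i) \<le> (\<Sum>i<n. ennreal (f i))"
    proof (induction n)
      case (Suc n)
      have "ennreal (a + b) \<le> ennreal a + ennreal b" for a b :: real
      proof -
        have "ennreal (a + b) \<le> ennreal (max 0 a + max 0 b)" by (intro ennreal_leI) auto
        also have "\<dots> = ennreal a + ennreal b" by (subst ennreal_plus) (auto simp: ennreal_max_0)
        finally show ?thesis .
      qed
      then have "ennreal (\<Sum>i<Suc n. f i) \<le> ennreal (\<Sum>i<n. f i) + ennreal (f n)" by simp
      also have "\<dots> \<le> (\<Sum>i<n. ennreal (f i)) + ennreal (f n)" using Suc by (rule add_right_mono)
      finally show ?case by simp
    qed simp
    also have "\<dots> \<le> (\<Sum>i. ennreal (f i))" by (intro sum_le_suminf) auto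
    finally show ?thesis .
  qed
  then show "\<exists>N. \<forall>n\<ge>N. ennreal (\<Sum>i<n. f i) \<le> (\<Sum>i. ennreal (f i))" by blast
qed

lemma ennreal_norm_le_suminf_of_sums:
  fixes f :: "nat \<Rightarrow> 'b::real_normed_vector"
  assumes "f sums s"
  shows "ennreal (norm s) \<le> (\<Sum>i. ennreal (norm (f i)))"
proof (rule LIMSEQ_le_const2)
  show "(\<lambda>n. ennreal (norm (\<Sum>i<n. f i))) \<longlonglongrightarrow> ennreal (norm s)"
    using assms unfolding sums_def by (intro tendsto_ennrealI tendsto_norm)
  have "ennreal (norm (\<Sum>i<n. f i)) \<le> (\<Sum>i. ennreal (norm (f i)))" for n
  proof -
    have "ennreal (norm (\<Sum>i<n. f i)) \<le> ennreal (\<Sum>i<n. norm (f i))" by (intro ennreal_leI norm_sum)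
    also have "\<dots> = (\<Sum>i<n. ennreal (norm (f i)))" by (simp add: sum_ennreal)
    also have "\<dots> \<le> (\<Sum>i. ennreal (norm (f i)))" by (intro sum_le_suminf) auto
    finally show ?thesis .
  qed
  then show "\<exists>N. \<forall>n\<ge>N. ennreal (norm (\<Sum>i<n. f i)) \<le> (\<Sum>i. ennreal (norm (f i)))" by blast
qed

lemma sums_empty_eq_0:
  fixes \<nu> :: "'a set \<Rightarrow> 'b::real_normed_vector"
  assumes sums: "\<And>A :: nat \<Rightarrow> 'a set. range A \<subseteq> sets M \<Longrightarrow> disjoint_family A \<Longrightarrow> (\<lambda>i. \<nu> (A i)) sums \<nu> (\<Union>i. A i)"
  shows "\<nu> {} = 0"
proof -
  have "(\<lambda>i::nat. \<nu> {}) sums \<nu> (\<Union>i::nat. {})"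
    using sums[of "\<lambda>_. {}"] by (auto simp: disjoint_family_on_def)
  then have "summable (\<lambda>i::nat. \<nu> {})" by (rule sums_summable)
  then show ?thesis by (simp add: summable_const_iff)
qed

lemma disjoint_family_binaryset:
  "A \<inter> B = {} \<Longrightarrow> disjoint_family (binaryset A B)"
  unfolding disjoint_family_on_def binaryset_def by (auto split: if_splits)

lemma sums_imp_additive:
  fixes \<nu> :: "'a set \<Rightarrow> 'b::real_normed_vector"
  assumes sums: "\<And>A :: nat \<Rightarrow> 'a set. range A \<subseteq> sets M \<Longrightarrow> disjoint_family A \<Longrightarrow> (\<lambda>i. \<nu> (A i)) sums \<nu> (\<Union>i. A i)"
    and AB: "A \<in> sets M" "B \<in> sets M" "A \<inter> B = {}"
  shows "\<nu> (A \<union> B) = \<nu> A + \<nu> B"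
proof -
  have "(\<lambda>i. \<nu> (binaryset A B i)) sums \<nu> (A \<union> B)"
    using sums[of "binaryset A B", OF _ disjoint_family_binaryset] AB
    unfolding UN_binaryset_eq range_binaryset_eq by simp
  moreover have "(\<lambda>i. \<nu> (binaryset A B i)) sums (\<nu> A + \<nu> B)"
    using sums_empty_eq_0[OF sums] by (intro binaryset_sums) auto
  ultimately show ?thesis by (rule sums_unique2)
qed

lemma emeasure_positive_variation:
  fixes \<nu> :: "'a set \<Rightarrow> real"
  assumes sums: "\<And>A :: nat \<Rightarrow> 'a set. range A \<subseteq> sets M \<Longrightarrow> disjoint_family A \<Longrightarrow> (\<lambda>i. \<nu> (A i)) sums \<nu> (\<Union>i. A i)"
    and E: "E \<in> sets M"
  shows "emeasure (positive_variation M \<nu>) E = (SUP A \<in> {A \<in> sets M. A \<subseteq> E}. ennreal (\<nu> A))"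
  unfolding positive_variation_def
proof (rule emeasure_measure_of_superadditive[OF _ _ _ E])
  let ?m = "\<lambda>E. SUP A \<in> {A \<in> sets M. A \<subseteq> E}. ennreal (\<nu> A)"
  have e0: "\<nu> {} = 0" using sums by (rule sums_empty_eq_0)
  have "{A \<in> sets M. A \<subseteq> {}} = {{}}" by auto
  then show "?m {} = 0" by (simp add: e0)
  show "?m A + ?m B \<le> ?m (A \<union> B)" if AB: "A \<in> sets M" "B \<in> sets M" "A \<inter> B = {}" for A B
  proof -
    have "ennreal (\<nu> X) + ennreal (\<nu> Y) \<le> ?m (A \<union> B)"
      if X: "X \<in> sets M" "X \<subseteq> A" and Y: "Y \<in> sets M" "Y \<subseteq> B" for X Y
    proof -
      \<comment> \<open>Sets of negative value are replaced by the empty set: \<open>ennreal\<close>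
        is additive only on nonnegative reals, and the truncated values do not change.\<close>
      define X' where "X' = (if \<nu> X \<ge> 0 then X else {})"
      define Y' where "Y' = (if \<nu> Y \<ge> 0 then Y else {})"
      have "ennreal (\<nu> X) + ennreal (\<nu> Y) = ennreal (\<nu> X') + ennreal (\<nu> Y')"
        by (simp add: X'_def Y'_def e0 ennreal_neg)
      also have "\<dots> = ennreal (\<nu> X' + \<nu> Y')"
        by (intro ennreal_plus[symmetric]) (auto simp: X'_def Y'_def e0)
      also have "\<nu> X' + \<nu> Y' = \<nu> (X' \<union> Y')"
        using X Y AB by (intro sums_imp_additive[OF sums, symmetric]) (auto simp: X'_def Y'_def)
      also have "ennreal \<dots> \<le> ?m (A \<union> B)"
        using X Y by (intro SUP_upper) (auto simp: X'_def Y'_def)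
      finally show ?thesis .
    qed
    then have "(SUP X \<in> {X \<in> sets M. X \<subseteq> A}. ennreal (\<nu> X) + ennreal (\<nu> Y)) \<le> ?m (A \<union> B)"
      if "Y \<in> sets M" "Y \<subseteq> B" for Y using that by (intro SUP_least) auto
    moreover have "(SUP X \<in> {X \<in> sets M. X \<subseteq> A}. ennreal (\<nu> X) + c) = ?m A + c" for c
      by (rule ennreal_SUP_add_left) auto
    ultimately have "(SUP Y \<in> {Y \<in> sets M. Y \<subseteq> B}. ?m A + ennreal (\<nu> Y)) \<le> ?m (A \<union> B)"
      by (intro SUP_least) auto
    moreover have "(SUP Y \<in> {Y \<in> sets M. Y \<subseteq> B}. ?m A + ennreal (\<nu> Y)) = ?m A + ?m B"
      by (rule ennreal_SUP_add_right[symmetric]) auto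
    ultimately show ?thesis by simp
  qed
  show "?m (\<Union>i. A i) \<le> (\<Sum>i. ?m (A i))" if A: "range A \<subseteq> sets M" "disjoint_family A" for A :: "nat \<Rightarrow> 'a set"
  proof (rule SUP_least)
    fix X assume "X \<in> {X \<in> sets M. X \<subseteq> (\<Union>i. A i)}"
    then have X: "X \<in> sets M" "X = (\<Union>i. X \<inter> A i)" by auto
    have "(\<lambda>i. \<nu> (X \<inter> A i)) sums \<nu> (\<Union>i. X \<inter> A i)"
      using A X(1) by (intro sums) (auto simp: disjoint_family_on_def)
    then have "ennreal (\<nu> X) \<le> (\<Sum>i. ennreal (\<nu> (X \<inter> A i)))"
      using X(2) by (intro ennreal_le_suminf_of_sums) simp
    also have "\<dots> \<le> (\<Sum>i. ?m (A i))"
      using A(1) X(1) by (intro suminf_le SUP_upper) auto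
    finally show "ennreal (\<nu> X) \<le> (\<Sum>i. ?m (A i))" .
  qed
qed

text \<open>For \<open>A\<close> inside \<open>E\<close>,
  \<open>\<nu> A = \<nu> E - \<nu> (E - A)\<close> is at most \<open>\<nu> E\<close> plus the
  negative variation of \<open>E\<close>. The supremum over \<open>A\<close> gives one inequality,
  the same argument for \<open>- \<nu>\<close> the other.\<close>

lemma jordan_decomposition:
  fixes \<nu> :: "'a set \<Rightarrow> real"
  assumes sums: "\<And>A :: nat \<Rightarrow> 'a set. range A \<subseteq> sets M \<Longrightarrow> disjoint_family A \<Longrightarrow> (\<lambda>i. \<nu> (A i)) sums \<nu> (\<Union>i. A i)"
    and E: "E \<in> sets M"
    and fin: "emeasure (positive_variation M \<nu>) E < \<infinity>" "emeasure (positive_variation M (\<lambda>E. - \<nu> E)) E < \<infinity>"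
  shows "\<nu> E = measure (positive_variation M \<nu>) E - measure (positive_variation M (\<lambda>E. - \<nu> E)) E"
proof -
  have half: "measure (positive_variation M \<eta>) E \<le> \<eta> E + measure (positive_variation M (\<lambda>E. - \<eta> E)) E"
    if s: "\<And>A :: nat \<Rightarrow> 'a set. range A \<subseteq> sets M \<Longrightarrow> disjoint_family A \<Longrightarrow> (\<lambda>i. \<eta> (A i)) sums \<eta> (\<Union>i. A i)"
      and f: "emeasure (positive_variation M (\<lambda>E. - \<eta> E)) E < \<infinity>" for \<eta>
  proof -
    define q where "q = measure (positive_variation M (\<lambda>E. - \<eta> E)) E"
    have s': "(\<lambda>i. - \<eta> (A i)) sums - \<eta> (\<Union>i. A i)" if "range A \<subseteq> sets M" "disjoint_family A" for A :: "nat \<Rightarrow> 'a set"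
      using s[OF that] by (rule sums_minus)
    have q: "- \<eta> A \<le> q" if "A \<in> sets M" "A \<subseteq> E" for A
    proof -
      have "ennreal (- \<eta> A) \<le> emeasure (positive_variation M (\<lambda>E. - \<eta> E)) E"
        using that by (subst emeasure_positive_variation[OF s' E]) (auto intro: SUP_upper2)
      also have "\<dots> = ennreal q" unfolding q_def using f by (intro emeasure_eq_ennreal_measure) auto
      finally show ?thesis by (simp only: q_def ennreal_le_iff[OF measure_nonneg])
    qed
    have "emeasure (positive_variation M \<eta>) E \<le> ennreal (\<eta> E + q)"
    proof (subst emeasure_positive_variation[OF s E], assumption, assumption, rule SUP_least)
      fix A assume A: "A \<in> {A \<in> sets M. A \<subseteq> E}"
      have "\<eta> E = \<eta> (A \<union> (E - A))" using A by (intro arg_cong[where f = \<eta>]) auto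
      also have "\<dots> = \<eta> A + \<eta> (E - A)" using A E by (intro sums_imp_additive[OF s]) auto
      finally show "ennreal (\<eta> A) \<le> ennreal (\<eta> E + q)"
        using q[of "E - A"] A E by (intro ennreal_leI) auto
    qed
    then have "measure (positive_variation M \<eta>) E \<le> \<eta> E + q"
      using q[OF E order.refl] unfolding measure_def by (intro enn2real_leI) auto
    then show ?thesis by (simp add: q_def)
  qed
  have s': "(\<lambda>i. - \<nu> (A i)) sums - \<nu> (\<Union>i. A i)" if "range A \<subseteq> sets M" "disjoint_family A" for A :: "nat \<Rightarrow> 'a set"
    using sums[OF that] by (rule sums_minus)
  have "measure (positive_variation M \<nu>) E \<le> \<nu> E + measure (positive_variation M (\<lambda>E. - \<nu> E)) E"
    using sums fin(2) by (rule half)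
  moreover have "measure (positive_variation M (\<lambda>E. - \<nu> E)) E \<le> - \<nu> E + measure (positive_variation M \<nu>) E"
    using half[of "\<lambda>E. - \<nu> E"] s' fin(1) by simp
  ultimately show ?thesis by simp
qed

lemma ennreal_suminf_swap:
  fixes f :: "nat \<Rightarrow> nat \<Rightarrow> ennreal"
  shows "(\<Sum>i. \<Sum>j. f i j) = (\<Sum>j. \<Sum>i. f i j)"
proof -
  have "(\<Sum>i. \<Sum>j. f i j) = (\<integral>\<^sup>+i. (\<Sum>j. f i j) \<partial>count_space UNIV)" by (simp add: nn_integral_count_space_nat)
  also have "\<dots> = (\<Sum>j. \<integral>\<^sup>+i. f i j \<partial>count_space UNIV)" by (intro nn_integral_suminf) simp
  also have "\<dots> = (\<Sum>j. \<Sum>i. f i j)" by (simp add: nn_integral_count_space_nat)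
  finally show ?thesis .
qed

text \<open>Superadditivity merges partitions of two disjoint sets. Subadditivity refines a
  partition of the union by the sets \<open>A i\<close> and exchanges the order of
  summation.\<close>

lemma emeasure_total_variation:
  assumes \<mu>: "complex_measure M \<mu>" and E: "E \<in> sets M"
  shows "emeasure (total_variation M \<mu>) E =
    (SUP A \<in> {A :: nat \<Rightarrow> 'a set. range A \<subseteq> sets M \<and> disjoint_family A \<and> (\<Union>i. A i) = E}.
       (\<Sum>i. ennreal (norm (\<mu> (A i)))))"
  unfolding total_variation_def
proof (rule emeasure_measure_of_superadditive[OF _ _ _ E])
  let ?P = "\<lambda>E. {A :: nat \<Rightarrow> 'a set. range A \<subseteq> sets M \<and> disjoint_family A \<and> (\<Union>i. A i) = E}"
  let ?s = "\<lambda>A. \<Sum>i. ennreal (norm (\<mu> (A i)))"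
  let ?m = "\<lambda>E. SUP A \<in> ?P E. ?s A"
  have sums: "(\<lambda>i. \<mu> (A i)) sums \<mu> (\<Union>i. A i)"
    if "range A \<subseteq> sets M" "disjoint_family A" for A :: "nat \<Rightarrow> 'a set"
    using \<mu> that by (auto simp: complex_measure_def)
  have e0: "\<mu> {} = 0" using sums by (rule sums_empty_eq_0)
  have ne: "?P E \<noteq> {}" if "E \<in> sets M" for E
  proof -
    have "binaryset E {} \<in> ?P E"
      using that by (auto simp: UN_binaryset_eq range_binaryset_eq disjoint_family_on_def binaryset_def)
    then show ?thesis by blast
  qed
  have "?s A = 0" if "A \<in> ?P {}" for A
  proof -
    have "A i = {}" for i using that by auto
    then show ?thesis by (simp add: e0)
  qed
  then have "?m {} \<le> 0" by (intro SUP_least) (simp only: order.refl)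
  then show "?m {} = 0" by (simp only: le_zero_eq)
  show "?m A + ?m B \<le> ?m (A \<union> B)" if AB: "A \<in> sets M" "B \<in> sets M" "A \<inter> B = {}" for A B
  proof -
    have comb: "?s X + ?s Y \<le> ?m (A \<union> B)" if X: "X \<in> ?P A" and Y: "Y \<in> ?P B" for X Y
    proof -
      \<comment> \<open>Rows 0 and 1 carry the two partitions, the other rows are empty;
        \<open>prod_decode\<close> lines the array up as one sequence.\<close>
      define W where "W = (\<lambda>(k::nat, n). if k = 0 then X n else if k = 1 then Y n else {})"
      define C where "C i = W (prod_decode i)" for i
      have "?s C = (\<Sum>k. \<Sum>n. ennreal (norm (\<mu> (W (k, n)))))"
        unfolding C_def by (rule suminf_ennreal_2dimen) simp
      also have "\<dots> = (\<Sum>k\<in>{0,1}. \<Sum>n. ennreal (norm (\<mu> (W (k, n)))))"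
        by (rule suminf_finite) (auto simp: W_def e0)
      also have "\<dots> = ?s X + ?s Y" by (simp add: W_def)
      finally have "?s X + ?s Y = ?s C" by simp
      also have "C \<in> ?P (A \<union> B)"
      proof (intro CollectI conjI)
        show "range C \<subseteq> sets M" using X Y by (auto simp: C_def W_def split: prod.split)
        show "disjoint_family C"
          unfolding disjoint_family_on_def
        proof (intro ballI impI)
          fix i j :: nat assume "i \<noteq> j"
          then have d: "prod_decode i \<noteq> prod_decode j" by simp
          obtain a b c e where ab: "prod_decode i = (a, b)" "prod_decode j = (c, e)" by (meson surj_pair)
          have XY: "X p \<inter> Y q = {}" "Y q \<inter> X p = {}" for p q using X Y AB by auto
          have XX: "X p \<inter> X q = {}" "Y p \<inter> Y q = {}" if "p \<noteq> q" for p q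
            using X Y that by (auto simp: disjoint_family_on_def)
          show "C i \<inter> C j = {}" using d ab XY XX[of b e] by (auto simp: C_def W_def)
        qed
        have "(\<Union>i. C i) = (\<Union>p. W p)"
          unfolding C_def using surj_prod_decode by (metis image_image)
        also have "\<dots> = (\<Union>n. X n) \<union> (\<Union>n. Y n)"
        proof
          show "(\<Union>p. W p) \<subseteq> (\<Union>n. X n) \<union> (\<Union>n. Y n)" by (auto simp: W_def split: if_splits)
          have "X n = W (0, n)" "Y n = W (1, n)" for n by (auto simp: W_def)
          then show "(\<Union>n. X n) \<union> (\<Union>n. Y n) \<subseteq> (\<Union>p. W p)" by blast
        qed
        finally show "(\<Union>i. C i) = A \<union> B" using X Y by simp
      qed
      then have "?s C \<le> ?m (A \<union> B)" by (rule SUP_upper)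
      finally show ?thesis .
    qed
    have "(SUP X \<in> ?P A. ?s X + ?s Y) \<le> ?m (A \<union> B)" if "Y \<in> ?P B" for Y
      using comb that by (intro SUP_least) auto
    moreover have "(SUP X \<in> ?P A. ?s X + c) = ?m A + c" for c
      by (rule ennreal_SUP_add_left) (rule ne[OF AB(1)])
    ultimately have "(SUP Y \<in> ?P B. ?m A + ?s Y) \<le> ?m (A \<union> B)"
      by (intro SUP_least) simp
    moreover have "(SUP Y \<in> ?P B. ?m A + ?s Y) = ?m A + ?m B"
      by (rule ennreal_SUP_add_right[symmetric]) (rule ne[OF AB(2)])
    ultimately show ?thesis by simp
  qed
  show "?m (\<Union>i. A i) \<le> (\<Sum>i. ?m (A i))" if A: "range A \<subseteq> sets M" "disjoint_family A" for A :: "nat \<Rightarrow> 'a set"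
  proof (rule SUP_least)
    fix C assume C: "C \<in> ?P (\<Union>i. A i)"
    have "ennreal (norm (\<mu> (C j))) \<le> (\<Sum>i. ennreal (norm (\<mu> (C j \<inter> A i))))" for j
    proof (rule ennreal_norm_le_suminf_of_sums)
      have "C j = (\<Union>i. C j \<inter> A i)" using C by auto
      moreover have "(\<lambda>i. \<mu> (C j \<inter> A i)) sums \<mu> (\<Union>i. C j \<inter> A i)"
        using A C by (intro sums) (auto simp: disjoint_family_on_def)
      ultimately show "(\<lambda>i. \<mu> (C j \<inter> A i)) sums \<mu> (C j)" by simp
    qed
    then have "?s C \<le> (\<Sum>j. \<Sum>i. ennreal (norm (\<mu> (C j \<inter> A i))))" by (intro suminf_le) auto
    also have "\<dots> = (\<Sum>i. \<Sum>j. ennreal (norm (\<mu> (C j \<inter> A i))))" by (rule ennreal_suminf_swap)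
    also have "\<dots> \<le> (\<Sum>i. ?m (A i))"
    proof (intro suminf_le)
      fix i
      have C': "disjoint_family C" "\<And>j. C j \<in> sets M" "A i \<subseteq> (\<Union>j. C j)" using C by auto
      have "A i \<in> sets M" using A(1) by auto
      with C'(2) have "range (\<lambda>j. C j \<inter> A i) \<subseteq> sets M" by blast
      moreover have "disjoint_family (\<lambda>j. C j \<inter> A i)"
        using C'(1) unfolding disjoint_family_on_def by blast
      moreover have "(\<Union>j. C j \<inter> A i) = A i" using C'(3) by blast
      ultimately have "(\<lambda>j. C j \<inter> A i) \<in> ?P (A i)" by simp
      then show "(\<Sum>j. ennreal (norm (\<mu> (C j \<inter> A i)))) \<le> ?m (A i)"
        by (rule SUP_upper2) simp
    qed auto
    finally show "?s C \<le> (\<Sum>i. ?m (A i))" .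
  qed
qed

lemma sets_total_variation [simp]: "sets (total_variation M \<mu>) = sets M"
  by (simp add: total_variation_def sets.sigma_sets_eq sets.space_closed)

lemma space_total_variation [simp]: "space (total_variation M \<mu>) = space M"
  by (simp add: total_variation_def space_measure_of sets.space_closed)

lemma sets_positive_variation [simp]: "sets (positive_variation M \<nu>) = sets M"
  by (simp add: positive_variation_def sets.sigma_sets_eq sets.space_closed)

lemma norm_le_total_variation:
  assumes \<mu>: "complex_measure M \<mu>" and E: "E \<in> sets M"
  shows "ennreal (norm (\<mu> E)) \<le> emeasure (total_variation M \<mu>) E"
proof -
  have e0: "\<mu> {} = 0" using \<mu> by (intro sums_empty_eq_0[of M]) (auto simp: complex_measure_def)
  have "(\<lambda>i. ennreal (norm (\<mu> (binaryset E {} i)))) sums (ennreal (norm (\<mu> E)) + ennreal (norm (\<mu> {})))"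
    by (rule binaryset_sums) (simp add: e0)
  then have "ennreal (norm (\<mu> E)) = (\<Sum>i. ennreal (norm (\<mu> (binaryset E {} i))))"
    by (simp add: sums_iff e0)
  also have "\<dots> \<le> emeasure (total_variation M \<mu>) E"
    unfolding emeasure_total_variation[OF \<mu> E] using E
    by (intro SUP_upper) (simp add: UN_binaryset_eq range_binaryset_eq disjoint_family_binaryset)
  finally show ?thesis .
qed

text \<open>Used for the zero set of the density of \<open>\<mu>\<close>.\<close>

lemma total_variation_eq_0:
  assumes \<mu>: "complex_measure M \<mu>" and E: "E \<in> sets M"
    and zero: "\<And>A. A \<in> sets M \<Longrightarrow> A \<subseteq> E \<Longrightarrow> \<mu> A = 0"
  shows "emeasure (total_variation M \<mu>) E = 0"
proof -
  have z: "(\<Sum>i. ennreal (norm (\<mu> (A i)))) = 0"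
    if "range A \<subseteq> sets M" "(\<Union>i. A i) = E" for A :: "nat \<Rightarrow> 'a set"
  proof -
    have "\<mu> (A i) = 0" for i using that by (intro zero) auto
    then show ?thesis by simp
  qed
  have "emeasure (total_variation M \<mu>) E \<le> 0"
    unfolding emeasure_total_variation[OF \<mu> E]
  proof (rule SUP_least, elim CollectE conjE)
    fix A :: "nat \<Rightarrow> 'a set" assume "range A \<subseteq> sets M" "(\<Union>i. A i) = E"
    then show "(\<Sum>i. ennreal (norm (\<mu> (A i)))) \<le> 0" by (simp only: z order.refl)
  qed
  then show ?thesis by simp
qed

lemma positive_variation_le_total_variation:
  fixes \<nu> :: "'a set \<Rightarrow> real"
  assumes \<mu>: "complex_measure M \<mu>"
    and sums: "\<And>A :: nat \<Rightarrow> 'a set. range A \<subseteq> sets M \<Longrightarrow> disjoint_family A \<Longrightarrow> (\<lambda>i. \<nu> (A i)) sums \<nu> (\<Union>i. A i)"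
    and le: "\<And>A. \<nu> A \<le> norm (\<mu> A)"
  shows "positive_variation M \<nu> \<le> total_variation M \<mu>"
proof -
  have "emeasure (positive_variation M \<nu>) E \<le> emeasure (total_variation M \<mu>) E" if E: "E \<in> sets M" for E
  proof (subst emeasure_positive_variation[OF sums E], assumption, assumption, rule SUP_least)
    fix A assume A: "A \<in> {A \<in> sets M. A \<subseteq> E}"
    have "ennreal (\<nu> A) \<le> ennreal (norm (\<mu> A))" using le by (rule ennreal_leI)
    also have "\<dots> \<le> emeasure (total_variation M \<mu>) A" using A by (intro norm_le_total_variation[OF \<mu>]) auto
    also have "\<dots> \<le> emeasure (total_variation M \<mu>) E" using A E by (intro emeasure_mono) auto
    finally show "ennreal (\<nu> A) \<le> emeasure (total_variation M \<mu>) E" .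
  qed
  then show ?thesis by (subst le_measure) auto
qed

text \<open>Domination implies absolute continuity, and finiteness of \<open>P\<close> allows a
  real-valued Radon-Nikodym derivative.\<close>

lemma finite_measure_le_density:
  fixes P V :: "'a measure"
  assumes V: "finite_measure V" and PV: "P \<le> V" "sets P = sets V"
  obtains d :: "'a \<Rightarrow> real" where "d \<in> borel_measurable V" "\<And>x. 0 \<le> d x" "P = density V (\<lambda>x. ennreal (d x))"
proof -
  interpret V: finite_measure V by (rule V)
  have le: "emeasure P A \<le> emeasure V A" for A
    using PV by (metis le_measureD3)
  have "finite_measure P"
  proof
    have "space P = space V" using PV(2) by (rule sets_eq_imp_space_eq)
    then show "emeasure P (space P) \<noteq> \<infinity>"
      using le[of "space V"] V.emeasure_finite[of "space V"] by (metis infinity_ennreal_def neq_top_trans)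
  qed
  moreover have ac: "absolutely_continuous V P"
    unfolding absolutely_continuous_def
  proof
    fix A assume "A \<in> null_sets V"
    then show "A \<in> null_sets P" using le[of A] PV(2) by (auto simp: null_sets_def)
  qed
  ultimately obtain d where d: "d \<in> borel_measurable V" "AE x in V. RN_deriv V P x = ennreal (d x)" "\<And>x. 0 \<le> d x"
    using V.real_RN_deriv[OF _ ac PV(2)] by metis
  have "P = density V (RN_deriv V P)" using V.density_RN_deriv[OF ac PV(2)] by simp
  also have "\<dots> = density V (\<lambda>x. ennreal (d x))" using d by (intro density_cong) auto
  finally show thesis using that d by blast
qed

text \<open>The four measures in \<open>complex_measure_integral\<close> are dominated by the total
  variation, so each has a density, and \<open>D\<close> combines these. On the zero set of
  \<open>D\<close> every measurable subset has \<open>\<mu>\<close>-value 0, so this set is null for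
  the total variation.\<close>

lemma complex_measure_density:
  assumes \<mu>: "complex_measure M \<mu>" and fin: "finite_measure (total_variation M \<mu>)"
  obtains D :: "'a \<Rightarrow> complex" where "D \<in> borel_measurable M"
    "\<And>g. integrable (total_variation M \<mu>) g \<Longrightarrow> integrable (total_variation M \<mu>) (\<lambda>x. g x * D x)"
    "\<And>g. integrable (total_variation M \<mu>) g \<Longrightarrow>
       complex_measure_integral M \<mu> g = (\<integral>x. g x * D x \<partial>total_variation M \<mu>)"
    "AE x in total_variation M \<mu>. D x \<noteq> 0"
proof -
  define V where "V = total_variation M \<mu>"
  interpret V: finite_measure V unfolding V_def by (rule fin)
  have setsV [simp, measurable_cong]: "sets V = sets M" by (simp add: V_def)
  have sums: "(\<lambda>i. \<mu> (A i)) sums \<mu> (\<Union>i. A i)"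
    if "range A \<subseteq> sets M" "disjoint_family A" for A :: "nat \<Rightarrow> 'a set"
    using \<mu> that by (auto simp: complex_measure_def)
  have dens: "\<exists>d. d \<in> borel_measurable V \<and> (\<forall>x. 0 \<le> d x) \<and> positive_variation M \<nu> = density V (\<lambda>x. ennreal (d x))"
    if "\<And>A :: nat \<Rightarrow> 'a set. range A \<subseteq> sets M \<Longrightarrow> disjoint_family A \<Longrightarrow> (\<lambda>i. \<nu> (A i)) sums \<nu> (\<Union>i. A i)"
      "\<And>A. \<nu> A \<le> norm (\<mu> A)" for \<nu> :: "'a set \<Rightarrow> real"
    using finite_measure_le_density[OF V.finite_measure_axioms, of "positive_variation M \<nu>"]
      positive_variation_le_total_variation[OF \<mu> that] unfolding V_def by (metis sets_positive_variation sets_total_variation)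
  have sR: "(\<lambda>i. Re (\<mu> (A i))) sums Re (\<mu> (\<Union>i. A i))" "(\<lambda>i. - Re (\<mu> (A i))) sums - Re (\<mu> (\<Union>i. A i))"
      "(\<lambda>i. Im (\<mu> (A i))) sums Im (\<mu> (\<Union>i. A i))" "(\<lambda>i. - Im (\<mu> (A i))) sums - Im (\<mu> (\<Union>i. A i))"
    if "range A \<subseteq> sets M" "disjoint_family A" for A :: "nat \<Rightarrow> 'a set"
    using sums[OF that] by (auto intro: sums_Re sums_Im sums_minus)
  have lR: "Re z \<le> norm z" "- Re z \<le> norm z" "Im z \<le> norm z" "- Im z \<le> norm z" for z
    using abs_Re_le_cmod[of z] abs_Im_le_cmod[of z] by auto
  obtain d1 where d1 [measurable]: "d1 \<in> borel_measurable V" and p1: "\<And>x. 0 \<le> d1 x"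
    and P1: "positive_variation M (\<lambda>E. Re (\<mu> E)) = density V (\<lambda>x. ennreal (d1 x))"
    using dens[of "\<lambda>E. Re (\<mu> E)"] sR(1) lR by auto
  obtain d2 where d2 [measurable]: "d2 \<in> borel_measurable V" and p2: "\<And>x. 0 \<le> d2 x"
    and P2: "positive_variation M (\<lambda>E. - Re (\<mu> E)) = density V (\<lambda>x. ennreal (d2 x))"
    using dens[of "\<lambda>E. - Re (\<mu> E)"] sR(2) lR by auto
  obtain d3 where d3 [measurable]: "d3 \<in> borel_measurable V" and p3: "\<And>x. 0 \<le> d3 x"
    and P3: "positive_variation M (\<lambda>E. Im (\<mu> E)) = density V (\<lambda>x. ennreal (d3 x))"
    using dens[of "\<lambda>E. Im (\<mu> E)"] sR(3) lR by auto
  obtain d4 where d4 [measurable]: "d4 \<in> borel_measurable V" and p4: "\<And>x. 0 \<le> d4 x"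
    and P4: "positive_variation M (\<lambda>E. - Im (\<mu> E)) = density V (\<lambda>x. ennreal (d4 x))"
    using dens[of "\<lambda>E. - Im (\<mu> E)"] sR(4) lR by auto
  define D where "D x = of_real (d1 x) - of_real (d2 x) + \<i> * (of_real (d3 x) - of_real (d4 x))" for x
  have int: "integrable V (\<lambda>x. g x * of_real (d x))" "(\<integral>x. g x \<partial>positive_variation M \<nu>) = (\<integral>x. g x * of_real (d x) \<partial>V)"
    if g: "integrable V g" and d [measurable]: "d \<in> borel_measurable V" and p: "\<And>x. 0 \<le> d x"
      and P: "positive_variation M \<nu> = density V (\<lambda>x. ennreal (d x))"
      and le: "positive_variation M \<nu> \<le> V" for g :: "'a \<Rightarrow> complex" and d \<nu>
  proof -
    have [measurable]: "g \<in> borel_measurable V" using g by simp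
    have "(\<integral>\<^sup>+x. norm (g x) \<partial>positive_variation M \<nu>) \<le> (\<integral>\<^sup>+x. norm (g x) \<partial>V)"
      using le by (intro nn_integral_mono_measure) auto
    also have "\<dots> < \<infinity>" using g by (simp add: integrable_iff_bounded)
    finally have "integrable (density V (\<lambda>x. ennreal (d x))) g"
      unfolding P by (simp add: integrable_iff_bounded)
    then show "integrable V (\<lambda>x. g x * of_real (d x))"
      using p by (subst (asm) integrable_density) (auto simp: scaleR_conv_of_real mult.commute)
    show "(\<integral>x. g x \<partial>positive_variation M \<nu>) = (\<integral>x. g x * of_real (d x) \<partial>V)"
      unfolding P using p by (subst integral_density) (auto simp: scaleR_conv_of_real mult.commute)
  qed
  have le: "positive_variation M (\<lambda>E. Re (\<mu> E)) \<le> V" "positive_variation M (\<lambda>E. - Re (\<mu> E)) \<le> V"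
    "positive_variation M (\<lambda>E. Im (\<mu> E)) \<le> V" "positive_variation M (\<lambda>E. - Im (\<mu> E)) \<le> V"
    unfolding V_def using sR lR by (intro positive_variation_le_total_variation[OF \<mu>]; blast)+
  have gD: "g x * D x = (g x * of_real (d1 x) - g x * of_real (d2 x)) + \<i> * (g x * of_real (d3 x) - g x * of_real (d4 x))"
    for g :: "'a \<Rightarrow> complex" and x by (simp add: D_def algebra_simps)
  have iD: "integrable V (\<lambda>x. g x * D x)" if g: "integrable V g" for g
    unfolding gD using int(1)[OF g d1 p1 P1 le(1)] int(1)[OF g d2 p2 P2 le(2)]
      int(1)[OF g d3 p3 P3 le(3)] int(1)[OF g d4 p4 P4 le(4)] by simp
  have eq: "complex_measure_integral M \<mu> g = (\<integral>x. g x * D x \<partial>V)" if g: "integrable V g" for g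
    unfolding gD complex_measure_integral_def
      int(2)[OF g d1 p1 P1 le(1)] int(2)[OF g d2 p2 P2 le(2)] int(2)[OF g d3 p3 P3 le(3)] int(2)[OF g d4 p4 P4 le(4)]
    using int(1)[OF g d1 p1 P1 le(1)] int(1)[OF g d2 p2 P2 le(2)]
      int(1)[OF g d3 p3 P3 le(3)] int(1)[OF g d4 p4 P4 le(4)] by simp
  \<comment> \<open>Recovers \<open>\<mu>\<close> from its integral: the integral of an indicator is
    evaluated by the Jordan decompositions of the real and imaginary parts.\<close>
  have \<mu>D: "\<mu> E = (\<integral>x. indicator E x * D x \<partial>V)" if E: "E \<in> sets M" for E
  proof -
    have "emeasure P E < \<infinity>" if "P \<le> V" "sets P = sets M" for P
    proof -
      have "emeasure P E \<le> emeasure V E" using that E by (simp add: le_measure)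
      then show ?thesis using V.emeasure_finite[of E] by (simp add: less_top[symmetric] top_unique[symmetric] neq_top_trans)
    qed
    then have f: "emeasure (positive_variation M (\<lambda>E. Re (\<mu> E))) E < \<infinity>"
      "emeasure (positive_variation M (\<lambda>E. - Re (\<mu> E))) E < \<infinity>"
      "emeasure (positive_variation M (\<lambda>E. Im (\<mu> E))) E < \<infinity>"
      "emeasure (positive_variation M (\<lambda>E. - Im (\<mu> E))) E < \<infinity>" using le by simp_all
    have ind: "(\<integral>x. indicator E x \<partial>P) = complex_of_real (measure P E)" if "sets P = sets M" for P
    proof -
      have "(\<integral>x. indicator E x \<partial>P) = (\<integral>x. complex_of_real (indicator E x) \<partial>P)"
        by (intro Bochner_Integration.integral_cong) (auto simp: indicator_def)
      also have "\<dots> = complex_of_real (measure P E)"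
        using E that by (simp add: sets_eq_imp_space_eq[OF that])
      finally show ?thesis .
    qed
    have "integrable V (indicator E :: 'a \<Rightarrow> complex)" 
      using E by (intro V.integrable_const_bound[of _ 1]) (auto simp: indicator_def)
    then have "(\<integral>x. indicator E x * D x \<partial>V) = complex_measure_integral M \<mu> (indicator E)" using eq by simp
    also have "\<dots> = of_real (Re (\<mu> E)) + \<i> * of_real (Im (\<mu> E))"
      unfolding complex_measure_integral_def
      by (simp only: ind sets_positive_variation jordan_decomposition[OF sR(1) E f(1,2)]
          jordan_decomposition[OF sR(3) E f(3,4)] of_real_diff)
    finally show ?thesis by (simp add: complex_eq[symmetric])
  qed
  have [measurable]: "D \<in> borel_measurable V" unfolding D_def by measurable
  have "emeasure V {x \<in> space M. D x = 0} = 0"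
    unfolding V_def
  proof (rule total_variation_eq_0[OF \<mu>])
    have "{x \<in> space V. D x = 0} \<in> sets V" by measurable
    then show "{x \<in> space M. D x = 0} \<in> sets M" by (simp add: V_def)
    fix A assume "A \<in> sets M" "A \<subseteq> {x \<in> space M. D x = 0}"
    then show "\<mu> A = 0"
      by (subst \<mu>D) (auto intro!: integral_eq_zero_AE AE_I2 simp: indicator_def)
  qed
  then have "AE x in V. D x \<noteq> 0"
    by (intro AE_I[of _ _ "{x \<in> space M. D x = 0}"]) (auto simp: V_def)
  moreover have "D \<in> borel_measurable M"
    using \<open>D \<in> borel_measurable V\<close> by (simp cong: measurable_cong_sets)
  ultimately show thesis
    using that[of D, folded V_def] iD eq by blast
qed

subsection \<open>Several variables\<close>

text \<open>The positive and the negative part of \<open>g\<close> are densities of finite measures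
  that agree on boxes, an intersection-stable generator. So the two parts coincide almost
  everywhere, which forces both to be 0.\<close>

lemma AE_eq_0_of_box_integrals:
  fixes g :: "'b::euclidean_space \<Rightarrow> real"
  assumes V [measurable_cong]: "sets V = sets borel" and g: "integrable V g"
    and zero: "\<And>a b. (\<integral>x. indicator (box a b) x * g x \<partial>V) = 0"
  shows "AE x in V. g x = 0"
proof -
  have [measurable]: "g \<in> borel_measurable V" using g by simp
  define p where "p s x = max 0 (s * g x)" for s x
  have pm [measurable]: "p s \<in> borel_measurable V" for s unfolding p_def by measurable
  have pi: "integrable V (p s)" for s unfolding p_def using g by auto
  have pn: "0 \<le> p s x" for s x by (simp add: p_def)
  have fin: "(\<integral>\<^sup>+x. ennreal (p s x) \<partial>V) \<noteq> \<infinity>" for s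
    using pi[of s] pn by (simp add: nn_integral_eq_integral)
  have bp: "integrable V (\<lambda>x. indicator (box a b) x * p s x)" for a b s
    by (rule Bochner_Integration.integrable_bound[OF pi[of s]]) (auto simp: indicator_def)
  have em: "emeasure (density V (\<lambda>x. ennreal (p s x))) (box a b) = ennreal (\<integral>x. indicator (box a b) x * p s x \<partial>V)" for s a b
  proof -
    have "emeasure (density V (\<lambda>x. ennreal (p s x))) (box a b) = (\<integral>\<^sup>+x. ennreal (p s x) * indicator (box a b) x \<partial>V)"
      by (intro emeasure_density) (auto simp: V)
    also have "\<dots> = (\<integral>\<^sup>+x. ennreal (indicator (box a b) x * p s x) \<partial>V)"
      by (intro nn_integral_cong) (auto simp: indicator_def)
    also have "\<dots> = ennreal (\<integral>x. indicator (box a b) x * p s x \<partial>V)"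
      using bp pn by (intro nn_integral_eq_integral) auto
    finally show ?thesis .
  qed
  have "density V (\<lambda>x. ennreal (p 1 x)) = density V (\<lambda>x. ennreal (p (-1) x))"
  proof (rule measure_eqI_generator_eq)
    let ?E = "range (\<lambda>(a, b). box a b :: 'b set)"
    let ?A = "\<lambda>n::nat. box (- (real n *\<^sub>R One)) (real n *\<^sub>R One) :: 'b set"
    show "Int_stable ?E" by (auto simp: Int_stable_def box_Int_box)
    show "?E \<subseteq> Pow UNIV" by simp
    show "sets (density V (\<lambda>x. ennreal (p 1 x))) = sigma_sets UNIV ?E"
      "sets (density V (\<lambda>x. ennreal (p (-1) x))) = sigma_sets UNIV ?E"
      by (simp_all add: V borel_eq_box)
    show "range ?A \<subseteq> ?E" "(\<Union>i. ?A i) = UNIV" unfolding UN_box_eq_UNIV by auto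
    show "emeasure (density V (\<lambda>x. ennreal (p 1 x))) (?A i) \<noteq> \<infinity>" for i by (simp add: em)
    fix X assume "X \<in> ?E"
    then obtain a b where X: "X = box a b" by auto
    have "(\<integral>x. indicator (box a b) x * p 1 x \<partial>V) - (\<integral>x. indicator (box a b) x * p (-1) x \<partial>V)
        = (\<integral>x. indicator (box a b) x * g x \<partial>V)"
      unfolding Bochner_Integration.integral_diff[OF bp bp, symmetric]
      by (intro Bochner_Integration.integral_cong) (auto simp: p_def max_def indicator_def)
    then show "emeasure (density V (\<lambda>x. ennreal (p 1 x))) X = emeasure (density V (\<lambda>x. ennreal (p (-1) x))) X"
      unfolding X em zero by simp
  qed
  then have "AE x in V. ennreal (p 1 x) = ennreal (p (-1) x)"
    using fin[of 1] by (subst (asm) finite_density_unique) auto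
  then show ?thesis
    by eventually_elim (use pn in \<open>auto simp: p_def max_def split: if_splits\<close>)
qed

text \<open>
  The coordinates are treated one at a time: a coordinate moved into \<open>S\<close> has its exponential replaced
  by an arbitrary indicator function, the others keep frequencies in \<open>\<Lambda>\<close>.
\<close>

lemma product_indicator_integral_eq_0:
  fixes h :: "real ^ 'n \<Rightarrow> complex" and \<phi> :: "real \<Rightarrow> real" and \<Lambda> :: "'n \<Rightarrow> real set"
  assumes V [measurable_cong]: "sets V = sets borel" and h: "integrable V h"
    and \<phi>: "\<And>x. 0 \<le> x \<Longrightarrow> 0 \<le> \<phi> x" "mono_on {0..} \<phi>"
      "(\<integral>\<^sup>+x\<in>{0..}. ennreal (\<phi> x / (1 + x\<^sup>2)) \<partial>lborel) = \<infinity>"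
    and W: "integrable V (\<lambda>x. exp (\<phi> (norm x)) * norm (h x))"
    and \<Lambda>: "\<And>j. closed (\<Lambda> j)" "\<And>j. 0 < emeasure lborel (\<Lambda> j)"
    and zero: "\<And>l. (\<And>j. l $ j \<in> \<Lambda> j) \<Longrightarrow> (\<integral>x. iexp (- (l \<bullet> x)) * h x \<partial>V) = 0"
    and A: "\<And>j. A j \<in> sets borel" and l: "\<And>j. l $ j \<in> \<Lambda> j"
  shows "(\<integral>x. (\<Prod>j\<in>S. indicator (A j) (x $ j)) * iexp (- (\<Sum>j\<in>-S. l $ j * x $ j)) * h x \<partial>V) = 0"
  using finite[of S] l
proof (induction S arbitrary: l rule: finite_induct)
  case empty
  then show ?case using zero[of l] by (simp add: inner_vec_def)
next
  case (insert k S)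
  define g where "g x = (\<Prod>j\<in>S. indicator (A j) (x $ j)) * iexp (- (\<Sum>j\<in>-insert k S. l $ j * x $ j)) * h x" for x
  have [measurable]: "h \<in> borel_measurable V" using h by simp
  have [measurable]: "A j \<in> sets borel" for j by (rule A)
  have r: "(\<lambda>x. x $ j) \<in> borel_measurable V" for j
    by (simp add: measurable_cong_sets[OF V refl])
  note r [measurable]
  have gm: "g \<in> borel_measurable V" unfolding g_def by measurable
  have ng: "norm (g x) \<le> norm (h x)" for x
  proof -
    have "norm (\<Prod>j\<in>S. indicator (A j) (x $ j) :: complex) \<le> 1"
      unfolding prod_norm[symmetric] by (intro prod_le_1) (auto simp: indicator_def)
    then show ?thesis by (simp add: g_def norm_mult mult_left_le_one_le)
  qed
  have gi: "integrable V g"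
    by (rule Bochner_Integration.integrable_bound[OF h gm]) (use ng in auto)
  define T where "T = (\<integral>x. exp (\<phi> (norm x)) * norm (h x) \<partial>V)"
  have "fourier_along V (\<lambda>x. x $ k) g t = 0" for t
  \<comment> \<open>The radial weight controls the tail in coordinate \<open>k\<close> because
    \<open>\<bar>x $ k\<bar> <= norm x\<close> and \<open>norm (g x) <= norm (h x)\<close>.\<close>
  proof (rule fourier_along_eq_0_of_positive_measure[OF r gi \<phi> _ \<Lambda>(1)[of k] \<Lambda>(2)[of k]])
    fix a :: real assume a: "0 \<le> a"
    have "(\<integral>x. indicator {x. a \<le> \<bar>x $ k\<bar>} x * norm (g x) \<partial>V)
        \<le> (\<integral>x. exp (- \<phi> a) * (exp (\<phi> (norm x)) * norm (h x)) \<partial>V)"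
    proof (rule integral_mono')
      show "integrable V (\<lambda>x. exp (- \<phi> a) * (exp (\<phi> (norm x)) * norm (h x)))" using W by simp
      fix x
      show "indicator {x. a \<le> \<bar>x $ k\<bar>} x * norm (g x) \<le> exp (- \<phi> a) * (exp (\<phi> (norm x)) * norm (h x))"
      proof (cases "a \<le> \<bar>x $ k\<bar>")
        case True
        then have "a \<le> norm x" using component_le_norm_cart[of x k] by linarith
        then have "\<phi> a \<le> \<phi> (norm x)" using a by (intro mono_onD[OF \<phi>(2)]) auto
        then have "1 * norm (g x) \<le> exp (\<phi> (norm x) - \<phi> a) * norm (h x)"
          using ng by (intro mult_mono) auto
        then show ?thesis using True by (simp add: exp_diff exp_minus divide_simps)
      qed simp
    qed auto
    also have "\<dots> = T * exp (- \<phi> a)" by (simp add: T_def mult.commute)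
    finally show "(\<integral>x. indicator {x. a \<le> \<bar>x $ k\<bar>} x * norm (g x) \<partial>V) \<le> T * exp (- \<phi> a)" .
  next
    fix t assume t: "t \<in> \<Lambda> k"
    define l' where "l' = (\<chi> j. if j = k then t else l $ j)"
    have l': "l' $ j \<in> \<Lambda> j" for j using t insert.prems by (simp add: l'_def)
    have sum_l': "(\<Sum>j\<in>-S. l' $ j * x $ j) = t * x $ k + (\<Sum>j\<in>-insert k S. l $ j * x $ j)" for x
    proof -
      have "-S = insert k (- insert k S)" using insert.hyps by auto
      then have "(\<Sum>j\<in>-S. l' $ j * x $ j) = l' $ k * x $ k + (\<Sum>j\<in>-insert k S. l' $ j * x $ j)"
        by (metis (no_types, lifting) Compl_iff finite insertI1 sum.insert)
      also have "(\<Sum>j\<in>-insert k S. l' $ j * x $ j) = (\<Sum>j\<in>-insert k S. l $ j * x $ j)"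
        by (intro sum.cong) (auto simp: l'_def)
      finally show ?thesis by (simp add: l'_def)
    qed
    have "iexp (- (t * x $ k)) * g x
        = (\<Prod>j\<in>S. indicator (A j) (x $ j)) * iexp (- (\<Sum>j\<in>-S. l' $ j * x $ j)) * h x" for x
    proof -
      have iexp_add: "iexp (- (a + b)) = iexp (- a) * iexp (- b)" for a b
        by (simp add: exp_add[symmetric] algebra_simps)
      show ?thesis unfolding sum_l' g_def by (simp only: iexp_add mult_ac)
    qed
    then show "fourier_along V (\<lambda>x. x $ k) g t = 0"
      using insert.IH[OF l'] unfolding fourier_along_def by simp
  qed
  \<comment> \<open>The transform in coordinate \<open>k\<close> now vanishes at all real
    frequencies, also outside \<open>\<Lambda> k\<close>, so the exponential can be exchanged for an
    indicator.\<close>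
  from integral_indicator_eq_0_of_fourier[OF r gi this A]
  show ?case using insert.hyps by (simp add: g_def mult.assoc)
qed

text \<open>For \<open>S = UNIV\<close> no exponential is left, and indicators of intervals multiply
  to the indicator of a box.\<close>

lemma AE_eq_0_of_fourier_product:
  fixes h :: "real ^ 'n \<Rightarrow> complex" and \<phi> :: "real \<Rightarrow> real" and \<Lambda> :: "'n \<Rightarrow> real set"
  assumes V: "sets V = sets borel" and h: "integrable V h"
    and \<phi>: "\<And>x. 0 \<le> x \<Longrightarrow> 0 \<le> \<phi> x" "mono_on {0..} \<phi>"
      "(\<integral>\<^sup>+x\<in>{0..}. ennreal (\<phi> x / (1 + x\<^sup>2)) \<partial>lborel) = \<infinity>"
    and W: "integrable V (\<lambda>x. exp (\<phi> (norm x)) * norm (h x))"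
    and \<Lambda>: "\<And>j. closed (\<Lambda> j)" "\<And>j. 0 < emeasure lborel (\<Lambda> j)"
    and zero: "\<And>l. (\<And>j. l $ j \<in> \<Lambda> j) \<Longrightarrow> (\<integral>x. iexp (- (l \<bullet> x)) * h x \<partial>V) = 0"
  shows "AE x in V. h x = 0"
proof -
  have "\<Lambda> j \<noteq> {}" for j using \<Lambda>(2)[of j] by auto
  then have "(SOME t. t \<in> \<Lambda> j) \<in> \<Lambda> j" for j by (simp add: some_in_eq)
  then obtain l0 where l0: "\<And>j. l0 j \<in> \<Lambda> j" by (rule that)
  have box: "(\<integral>x. indicator (box a b) x * h x \<partial>V) = 0" for a b
  proof -
    have "(\<Prod>j\<in>UNIV. indicator {a $ j<..<b $ j} (x $ j)) = (indicator (box a b) x :: complex)" for x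
    proof (cases "x \<in> box a b")
      case False
      then obtain j where "x $ j \<notin> {a $ j<..<b $ j}" by (auto simp: mem_box_cart)
      then have "indicator {a $ j<..<b $ j} (x $ j) = (0::complex)" by (rule indicator_simps(2))
      then have "(\<Prod>j\<in>UNIV. indicator {a $ j<..<b $ j} (x $ j)) = (0::complex)"
        by (intro prod_zero bexI[of _ j]) auto
      then show ?thesis using False by simp
    qed (simp add: mem_box_cart)
    moreover have "(\<integral>x. (\<Prod>j\<in>UNIV. indicator {a $ j<..<b $ j} (x $ j)) * iexp (- (\<Sum>j\<in>-UNIV. (\<chi> j. l0 j) $ j * x $ j)) * h x \<partial>V) = 0"
    proof (rule product_indicator_integral_eq_0[OF V h \<phi> W \<Lambda>])
      show "(\<integral>x. iexp (- (l \<bullet> x)) * h x \<partial>V) = 0" if "\<And>j. l $ j \<in> \<Lambda> j" for l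
        using that by (rule zero)
    qed (use l0 in auto)
    ultimately show ?thesis by simp
  qed
  have bi: "integrable V (\<lambda>x. indicator (box a b) x * h x)" for a b
    by (rule Bochner_Integration.integrable_bound[OF h]) (use V h in \<open>auto simp: indicator_def\<close>)
  have "(\<integral>x. indicator (box a b) x * Re (h x) \<partial>V) = Re (\<integral>x. indicator (box a b) x * h x \<partial>V)" for a b
    unfolding integral_Re[OF bi, symmetric] by (intro Bochner_Integration.integral_cong) (auto simp: indicator_def)
  then have "AE x in V. Re (h x) = 0"
    using h by (intro AE_eq_0_of_box_integrals[OF V]) (simp_all add: box)
  moreover have "(\<integral>x. indicator (box a b) x * Im (h x) \<partial>V) = Im (\<integral>x. indicator (box a b) x * h x \<partial>V)" for a b
    unfolding integral_Im[OF bi, symmetric] by (intro Bochner_Integration.integral_cong) (auto simp: indicator_def)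
  then have "AE x in V. Im (h x) = 0"
    using h by (intro AE_eq_0_of_box_integrals[OF V]) (simp_all add: box)
  ultimately show ?thesis by eventually_elim (simp add: complex_eq_iff)
qed

section \<open>The weight for \<open>L^p\<close> densities and the conclusion\<close>

text \<open>The cases decide which term dominates: the product is at most \<open>exp s\<close> if
  \<open>u <= exp (s / q)\<close>, and at most \<open>u powr q\<close> otherwise. In the application
  \<open>q\<close> is the exponent \<open>p\<close> itself and \<open>1 - 1 / q\<close> the
  reciprocal of its conjugate.\<close>

lemma young_exp:
  fixes u s q :: real
  assumes "0 \<le> u" "1 < q"
  shows "exp ((1 - 1 / q) * s) * u \<le> u powr q + exp s"
proof (cases "u \<le> exp (s / q)")
  case True
  have "exp ((1 - 1 / q) * s) * u \<le> exp ((1 - 1 / q) * s) * exp (s / q)"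
    using True by simp
  also have "\<dots> = exp s" by (simp add: algebra_simps flip: exp_add)
  finally show ?thesis by (simp add: add_increasing)
next
  case False
  then have u: "exp (s / q) < u" "0 < u" using exp_gt_zero[of "s / q"] by linarith+
  have "exp ((1 - 1 / q) * s) = exp (s / q) powr (q - 1)"
    using assms by (simp add: powr_def field_simps)
  also have "\<dots> \<le> u powr (q - 1)" using u assms by (intro powr_mono2) auto
  finally have "exp ((1 - 1 / q) * s) * u \<le> u powr (q - 1) * u powr 1" using u by simp
  also have "\<dots> = u powr q" unfolding powr_add[symmetric] by simp
  finally show ?thesis by (simp add: add_increasing2)
qed

theorem corollary2p1:
  fixes \<psi> :: "real \<Rightarrow> real"
    and \<mu> :: "(real ^ 'n) set \<Rightarrow> complex"
    and p :: ennreal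
    and f :: "real ^ 'n \<Rightarrow> complex"
    and \<Lambda> :: "'n \<Rightarrow> real set"
  assumes "\<And>x. 0 \<le> x \<Longrightarrow> 0 \<le> \<psi> x"
    and "mono_on {0..} \<psi>"
    and "(\<integral>\<^sup>+x\<in>{0..}. ennreal (\<psi> x / (1 + x\<^sup>2)) \<partial>lborel) = \<infinity>"
    and "complex_measure borel \<mu>"
    and "(\<integral>\<^sup>+x. ennreal (exp (\<psi> (norm x))) \<partial>total_variation borel \<mu>) < \<infinity>"
    and "1 < p"
    and "in_Lp p (total_variation borel \<mu>) f"
    and "\<And>j. closed (\<Lambda> j)"
    and "\<And>j. 0 < emeasure lborel (\<Lambda> j)"
    and "\<And>l. l \<in> {l. \<forall>j. l $ j \<in> \<Lambda> j} \<Longrightarrow> fourier_density \<mu> f l = 0"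
  shows "AE x in total_variation borel \<mu>. f x = 0"
proof -
  define V where "V = total_variation borel \<mu>"
  have sV [measurable_cong]: "sets V = sets borel" by (simp add: V_def)
  have fm [measurable]: "f \<in> borel_measurable V" using assms(7) by (simp add: in_Lp_def V_def)
  have expV: "(\<integral>\<^sup>+x. ennreal (exp (\<psi> (norm x))) \<partial>V) < \<infinity>" using assms(5) by (simp add: V_def)
  \<comment> \<open>Continuing \<open>\<psi>\<close> to the left by \<open>\<psi> 0\<close> makes it
    monotone on the whole line, hence Borel.\<close>
  have "mono (\<lambda>x. \<psi> (max 0 x))"
    by (intro monoI mono_onD[OF assms(2)]) auto
  then have \<psi>m [measurable]: "(\<lambda>x. \<psi> (max 0 x)) \<in> borel_measurable borel" by (rule borel_measurable_mono)
  have "(\<lambda>x. \<psi> (max 0 (norm x))) \<in> borel_measurable V"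
    by (rule measurable_compose[OF _ \<psi>m]) measurable
  then have \<psi>V [measurable]: "(\<lambda>x. \<psi> (norm x)) \<in> borel_measurable V" by simp
  \<comment> \<open>The weight is at least 1, so its integral bounds the total mass.\<close>
  have "emeasure V (space V) = (\<integral>\<^sup>+x. 1 \<partial>V)" by simp
  also have "\<dots> \<le> (\<integral>\<^sup>+x. ennreal (exp (\<psi> (norm x))) \<partial>V)"
    using assms(1) by (intro nn_integral_mono) (simp flip: ennreal_1)
  finally have "emeasure V (space V) < \<infinity>" using expV by (rule order.strict_trans1)
  then have fin: "finite_measure V" by (intro finite_measureI) auto
  \<comment> \<open>The reciprocal of the conjugate exponent of \<open>p\<close>; it is positive
    because \<open>1 < p\<close>, so scaling \<open>\<psi>\<close> by it keeps the integral
    divergent.\<close>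
  define c where "c = (if p = \<infinity> then 1 else 1 - 1 / enn2real p)"
  have q: "1 < enn2real p" if "p \<noteq> \<infinity>"
    using assms(6) that by (cases p) (auto simp: ennreal_less_iff simp flip: ennreal_1)
  then have c: "0 < c" by (auto simp: c_def)
  define \<phi> where "\<phi> x = c * \<psi> x" for x
  have \<phi>0: "0 \<le> \<phi> x" if "0 \<le> x" for x using c assms(1)[OF that] by (simp add: \<phi>_def)
  have \<phi>m: "mono_on {0..} \<phi>"
    using c by (auto simp: \<phi>_def intro!: mono_onI mono_onD[OF assms(2)])
  have \<phi>d: "(\<integral>\<^sup>+x\<in>{0..}. ennreal (\<phi> x / (1 + x\<^sup>2)) \<partial>lborel) = \<infinity>"
  proof -
    have "(\<integral>\<^sup>+x\<in>{0..}. ennreal (\<phi> x / (1 + x\<^sup>2)) \<partial>lborel)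
        = (\<integral>\<^sup>+x. ennreal c * (ennreal (\<psi> (max 0 x) / (1 + x\<^sup>2)) * indicator {0..} x) \<partial>lborel)"
      using c assms(1) by (intro nn_integral_cong) (auto simp: \<phi>_def indicator_def max_def simp flip: ennreal_mult)
    also have "\<dots> = ennreal c * (\<integral>\<^sup>+x. ennreal (\<psi> (max 0 x) / (1 + x\<^sup>2)) * indicator {0..} x \<partial>lborel)"
      by (intro nn_integral_cmult) measurable
    also have "(\<integral>\<^sup>+x. ennreal (\<psi> (max 0 x) / (1 + x\<^sup>2)) * indicator {0..} x \<partial>lborel)
        = (\<integral>\<^sup>+x\<in>{0..}. ennreal (\<psi> x / (1 + x\<^sup>2)) \<partial>lborel)"
      by (intro nn_integral_cong) (auto simp: indicator_def max_def)
    also have "\<dots> = \<infinity>" by (rule assms(3))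
    finally show ?thesis using c by (simp add: ennreal_mult_top)
  qed
  have "(\<integral>\<^sup>+x. ennreal (exp (\<phi> (norm x)) * norm (f x)) \<partial>V) < \<infinity>"
  proof (cases "p = \<infinity>")
    case True
    then have es: "esssup V (\<lambda>x. ennreal (norm (f x))) < \<infinity>" using assms(7) by (simp add: in_Lp_def V_def)
    have "(\<integral>\<^sup>+x. ennreal (exp (\<phi> (norm x)) * norm (f x)) \<partial>V)
        \<le> (\<integral>\<^sup>+x. esssup V (\<lambda>x. ennreal (norm (f x))) * ennreal (exp (\<psi> (norm x))) \<partial>V)"
    proof (rule nn_integral_mono_AE)
      show "AE x in V. ennreal (exp (\<phi> (norm x)) * norm (f x))
          \<le> esssup V (\<lambda>x. ennreal (norm (f x))) * ennreal (exp (\<psi> (norm x)))"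
        using esssup_AE[of "\<lambda>x. ennreal (norm (f x))" V]
        by eventually_elim (simp add: \<phi>_def c_def True ennreal_mult mult.commute[of "ennreal (exp _)"] mult_right_mono)
    qed
    also have "\<dots> = esssup V (\<lambda>x. ennreal (norm (f x))) * (\<integral>\<^sup>+x. ennreal (exp (\<psi> (norm x))) \<partial>V)"
      by (intro nn_integral_cmult) measurable
    also have "\<dots> < \<infinity>" using es expV by (simp add: ennreal_mult_less_top)
    finally show ?thesis .
  next
    case False
    then have Lp: "(\<integral>\<^sup>+x. ennreal (norm (f x) powr enn2real p) \<partial>V) < \<infinity>"
      using assms(7) by (simp add: in_Lp_def V_def)
    have "(\<integral>\<^sup>+x. ennreal (exp (\<phi> (norm x)) * norm (f x)) \<partial>V)
        \<le> (\<integral>\<^sup>+x. ennreal (norm (f x) powr enn2real p) + ennreal (exp (\<psi> (norm x))) \<partial>V)"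
      using young_exp[OF norm_ge_zero q[OF False]] False
      by (intro nn_integral_mono) (auto simp: \<phi>_def c_def simp flip: ennreal_plus intro!: ennreal_leI)
    also have "\<dots> = (\<integral>\<^sup>+x. ennreal (norm (f x) powr enn2real p) \<partial>V) + (\<integral>\<^sup>+x. ennreal (exp (\<psi> (norm x))) \<partial>V)"
      by (intro nn_integral_add) measurable
    also have "\<dots> < \<infinity>" using Lp expV by simp
    finally show ?thesis .
  qed
  \<comment> \<open>Put as integrability of a complex function, so that \<open>D(2)\<close> also
    yields the weighted integrability of \<open>f x * D x\<close>.\<close>
  then have Wf: "integrable V (\<lambda>x. complex_of_real (exp (\<phi> (norm x))) * f x)"
    unfolding \<phi>_def by (subst integrable_iff_bounded) (auto simp: norm_mult)
  have f: "integrable V f"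
    using \<phi>0 by (intro Bochner_Integration.integrable_bound[OF Wf fm] AE_I2) (auto simp: norm_mult mult_le_cancel_right1)
  obtain D where D: "D \<in> borel_measurable borel"
    "\<And>g. integrable V g \<Longrightarrow> integrable V (\<lambda>x. g x * D x)"
    "\<And>g. integrable V g \<Longrightarrow> complex_measure_integral borel \<mu> g = (\<integral>x. g x * D x \<partial>V)"
    "AE x in V. D x \<noteq> 0"
    using complex_measure_density[OF assms(4) fin[unfolded V_def], folded V_def] by blast
  have "AE x in V. f x * D x = 0"
  proof (rule AE_eq_0_of_fourier_product[OF sV D(2)[OF f] \<phi>0 \<phi>m \<phi>d _ assms(8,9)])
    show "integrable V (\<lambda>x. exp (\<phi> (norm x)) * norm (f x * D x))"
      using integrable_norm[OF D(2)[OF Wf]] by (simp add: norm_mult mult.assoc)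
    fix l :: "real ^ 'n" assume l: "\<And>j. l $ j \<in> \<Lambda> j"
    have "integrable V (\<lambda>x. iexp (- (1 * (l \<bullet> x))) * f x)"
      by (rule integrable_iexp_mult[OF _ f]) measurable
    then have "fourier_density \<mu> f l = (\<integral>x. exp (- (\<i> * complex_of_real (l \<bullet> x))) * f x * D x \<partial>V)"
      unfolding fourier_density_def by (intro D(3)) simp
    then show "(\<integral>x. iexp (- (l \<bullet> x)) * (f x * D x) \<partial>V) = 0"
      using assms(10)[of l] l by (simp add: mult.assoc)
  qed
  with D(4) have "AE x in V. f x = 0" by eventually_elim simp
  then show ?thesis unfolding V_def .
qed

end
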